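(* Let $q=2^h$ and $\alpha,\beta\in\mathbb{F}_q\setminus\{0,1\}$ with $\alpha\beta\neq 1$. The KM-arc $\mathcal{A}_{\alpha,\beta,0,0}$ is a translation KM-arc if and only if $\alpha\in\left\{\frac{1}{\beta^2},\ 1+\frac{1}{\beta},\ \beta,\ \frac{1}{\sqrt{\beta}},\ \frac{1}{\beta+1}\right\}$.
   Context: Let $\mathrm{Tr}$ be the absolute trace $\mathbb{F}_q\to\mathbb{F}_2$ and $\sqrt{\beta}$ the unique square root in $\mathbb{F}_q$. Put $\gamma=\frac{\beta+1}{\alpha\beta+1}$, $\xi=\alpha\beta\gamma$, and let $\mathcal{A}_{\alpha,\beta,0,0}\subseteq\mathrm{PG}(2,q)$ be the union of $S_0=\{(z,1,0): \mathrm{Tr}(z)=0,\mathrm{Tr}(z/\alpha)=0\}$, $S_1=\{(z,0,1):\mathrm{Tr}(z)=0,\mathrm{Tr}(z/(\alpha\gamma))=0\}$, $S_2=\{(z,1,1):\mathrm{Tr}(z)=1,\mathrm{Tr}(z/(\alpha\beta))=0\}$, $S_3=\{(z,\gamma,1):\mathrm{Tr}(z/(\alpha\gamma))=1,\mathrm{Tr}(z/\xi)=1\}$, $S_4=\{(z,\beta+1,1):\mathrm{Tr}(z/(\alpha\beta))=1,\mathrm{Tr}(z/\xi)=0\}$ ($z\in\mathbb{F}_q$), a KM-arc of type $q/4$ (a set of $q+q/4$ points meeting every line in $0$, $2$ or $q/4$ points). A point set $S$ is a translation set with respect to a line $\ell$ if the group of elations with axis $\ell$ fixing $S$ acts transitively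 on $S\setminus\ell$; a translation KM-arc is a KM-arc that is a translation set with respect to some line. *)

theory Defs
  imports "HOL-Analysis.Analysis"
begin

(* The projective plane PG(2,F): points are the one-dimensional subspaces of F^3;
   a line is the set of all points contained in a fixed two-dimensional subspace. *)

definition pg_points :: "('a::field ^ 3) set set" where
  "pg_points = {P. vec.subspace P \<and> vec.dim P = 1}"

definition pg_lines :: "('a::field ^ 3) set set set" where
  "pg_lines = {{P \<in> pg_points. P \<subseteq> L} | L. vec.subspace L \<and> vec.dim L = 2}"

definition pg_point :: "'a::field \<Rightarrow> 'a \<Rightarrow> 'a \<Rightarrow> ('a ^ 3) set" where
  "pg_point x y z = vec.span {vector [x, y, z]}"

(* Values of a collineation outside pg_points are irrelevant. *)
definition collineation :: "(('a::field ^ 3) set \<Rightarrow> ('a ^ 3) set) \<Rightarrow> bool" where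
  "collineation f \<longleftrightarrow> bij_betw f pg_points pg_points \<and> bij_betw (image f) pg_lines pg_lines"

(* An elation with axis l fixes l pointwise and fixes every line through some point
   (its centre) on l; the identity counts as an elation. *)
definition elation :: "('a::field ^ 3) set set \<Rightarrow> (('a ^ 3) set \<Rightarrow> ('a ^ 3) set) \<Rightarrow> bool" where
  "elation l f \<longleftrightarrow> collineation f \<and> (\<forall>P\<in>l. f P = P) \<and>
     (\<exists>C\<in>l. \<forall>m\<in>pg_lines. C \<in> m \<longrightarrow> f ` m = m)"

definition translation_set :: "('a::field ^ 3) set set \<Rightarrow> ('a ^ 3) set set \<Rightarrow> bool" where
  "translation_set l S \<longleftrightarrow>
     (\<forall>P\<in>S - l. \<forall>Q\<in>S - l. \<exists>f. elation l f \<and> f ` S = S \<and> f P = Q)"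

definition KM_arc :: "nat \<Rightarrow> ('a::{field,finite} ^ 3) set set \<Rightarrow> bool" where
  "KM_arc t S \<longleftrightarrow> S \<subseteq> pg_points \<and> card S = CARD('a) + t \<and>
     (\<forall>l\<in>pg_lines. card (S \<inter> l) \<in> {0, 2, t})"

definition translation_KM_arc :: "nat \<Rightarrow> ('a::{field,finite} ^ 3) set set \<Rightarrow> bool" where
  "translation_KM_arc t S \<longleftrightarrow> KM_arc t S \<and> (\<exists>l\<in>pg_lines. translation_set l S)"

(* The absolute trace of a field with 2^h elements; its values lie in the prime
   subfield {0, 1}, which plays the role of F_2. *)
definition abs_trace :: "nat \<Rightarrow> 'a::field \<Rightarrow> 'a" where
  "abs_trace h x = (\<Sum>i<h. x ^ (2 ^ i))"

(* Well-defined in finite fields of characteristic 2, where squaring is bijective. *)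
definition field_sqrt :: "'a::field \<Rightarrow> 'a" where
  "field_sqrt b = (THE s. s ^ 2 = b)"

definition km_gamma :: "'a::field \<Rightarrow> 'a \<Rightarrow> 'a" where
  "km_gamma \<alpha> \<beta> = (\<beta> + 1) / (\<alpha> * \<beta> + 1)"

definition km_xi :: "'a::field \<Rightarrow> 'a \<Rightarrow> 'a" where
  "km_xi \<alpha> \<beta> = \<alpha> * \<beta> * km_gamma \<alpha> \<beta>"

(* The point set A_{alpha,beta,0,0} over the field with 2^h elements. *)
definition km_set :: "nat \<Rightarrow> 'a::field \<Rightarrow> 'a \<Rightarrow> ('a ^ 3) set set" where
  "km_set h \<alpha> \<beta> = (let Tr = abs_trace h; \<gamma> = km_gamma \<alpha> \<beta>; \<xi> = km_xi \<alpha> \<beta> in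
     {pg_point z 1 0 | z. Tr z = 0 \<and> Tr (z / \<alpha>) = 0} \<union>
     {pg_point z 0 1 | z. Tr z = 0 \<and> Tr (z / (\<alpha> * \<gamma>)) = 0} \<union>
     {pg_point z 1 1 | z. Tr z = 1 \<and> Tr (z / (\<alpha> * \<beta>)) = 0} \<union>
     {pg_point z \<gamma> 1 | z. Tr (z / (\<alpha> * \<gamma>)) = 1 \<and> Tr (z / \<xi>) = 1} \<union>
     {pg_point z (\<beta> + 1) 1 | z. Tr (z / (\<alpha> * \<beta>)) = 1 \<and> Tr (z / \<xi>) = 0})"

end

theory Submission
  imports Defs "HOL-Computational_Algebra.Polynomial"
begin

text \<open>
  The five pieces of the arc lie on five lines through the nucleus \<open>N = (1, 0, 0)\<close>. If \<open>q > 8\<close>, these are the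
  only lines meeting the arc in more than two points, so every collineation preserving the arc fixes \<open>N\<close>;
  hence an elation whose axis misses \<open>N\<close> cannot move a point of one piece to another one, and a
  translation axis passes through \<open>N\<close>. Away from such an axis, elations act on the pencil of \<open>N\<close> as
  translations of an affine line in characteristic 2. They are fixed-point-free involutions permuting
  the parameters of the pieces off the axis, so there cannot be five of these; the axis therefore
  carries one piece, and the set of the four remaining parameters is invariant under its own
  differences, that is, the parameters sum to 0. For each of the five possible axes this is one of
  the five equations. Conversely, each equation makes the four remaining pieces, in suitable affine
  coordinates, closed under ternary sums. For \<open>q \<le> 8\<close> one of the equations always holds.
\<close>

section \<open>Finite fields of characteristic 2 and the trace\<close>

text \<open>An \<open>elation\<close> is given only as a bijection of points that permutes the
  lines, without a matrix. The necessity half must therefore first show that off its axis it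
  translates normalised vectors by a constant, while the sufficiency half builds its elations as
  linear shears. A form \<open>a\<close> with \<open>a $ 1 = 0\<close> takes one value
  \<open>\<phi> a k\<close> on all standard vectors of piece k; with a second form \<open>b\<close>
  as coordinate, the parameter of that piece is \<open>\<phi> b k / \<phi> a k\<close>. The
  derivation of the five equations looks only at these parameters. The converse also uses that,
  after normalisation, the first coordinates of the four pieces are cosets of one common group cut
  out by two traces, whose labels in F_2^2 sum to 0 as well. The KM-arc property is part of the
  claim; it rests on the identity 1/\<xi> = 1 + 1/(\<alpha>\<gamma>) + 1/(\<alpha>\<beta>), which
  lets six trace values decide how a line off the nucleus meets all five pieces.\<close>

lemma finite_field_power_card:
  fixes x :: "'a::{field,finite}"
  shows "x ^ CARD('a) = x"
proof (cases "x = 0")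
  case False
  define U where "U = UNIV - {0::'a}"
  have inj: "inj_on ((*) x) U"
    using False by (auto simp: inj_on_def)
  have img: "(*) x ` U = U"
  proof
    show "U \<subseteq> (*) x ` U"
    proof
      fix y assume "y \<in> U"
      then have "y = x * (y / x)" "y / x \<in> U" using False by (auto simp: U_def)
      then show "y \<in> (*) x ` U" by blast
    qed
  qed (use False in \<open>auto simp: U_def\<close>)
  \<comment> \<open>Multiplication by \<open>x\<close> permutes the units, so the product of all
    units cancels against that of their multiples.\<close>
  have "\<Prod>U = (\<Prod>y\<in>U. x * y)"
    using prod.reindex[OF inj, of "\<lambda>y. y"] img by simp
  also have "\<dots> = x ^ card U * \<Prod>U"
    by (simp add: prod.distrib)
  finally have "x ^ card U = 1"
    by (auto simp: U_def)
  moreover have "CARD('a) = Suc (card U)"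
    unfolding U_def using card.remove[of "UNIV :: 'a set" 0] by simp
  ultimately show ?thesis by simp
qed (simp add: card_gt_0_iff)

text \<open>Shifting the sum of all field elements by 1 leaves it unchanged, so the field size, a
  power of 2, vanishes in the field.\<close>

lemma two_eq_zero:
  assumes "CARD('a::{field,finite}) = 2 ^ h"
  shows "(2::'a) = 0"
proof -
  have "(\<Sum>x\<in>(UNIV::'a set). x) = (\<Sum>x\<in>(UNIV::'a set). x + 1)"
  proof (rule sum.reindex_bij_witness[of _ "\<lambda>x. x + 1" "\<lambda>x. x - 1"])
  qed auto
  then have "of_nat CARD('a) = (0::'a)"
    by (simp add: sum.distrib)
  then have "(2::'a) ^ h = 0"
    using assms by (metis of_nat_numeral of_nat_power)
  then show ?thesis by simp
qed

text \<open>Comparing the sum over \<open>T\<close> with that over its translate gives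
  \<open>card T * s = 0\<close>. In characteristic 2 this says that \<open>T\<close> has even size,
  which rules out five parameters off an axis.\<close>

lemma of_nat_card_translation_invariant:
  fixes s :: "'a::field"
  assumes "finite T" "s \<noteq> 0" "(\<lambda>x. x + s) ` T \<subseteq> T"
  shows "of_nat (card T) = (0::'a)"
proof -
  have inj: "inj_on (\<lambda>x. x + s) T" by (auto simp: inj_on_def)
  have "(\<lambda>x. x + s) ` T = T"
    using assms inj by (meson endo_inj_surj)
  then have "\<Sum>T = (\<Sum>x\<in>T. x + s)"
    using sum.reindex[OF inj, of "\<lambda>y. y"] by simp
  also have "\<dots> = \<Sum>T + of_nat (card T) * s"
    by (simp add: sum.distrib)
  finally show ?thesis using assms(2) by simp
qed

text \<open>Working modulo these rewrite rules turns \<open>algebra_simps\<close> into a decision procedure for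
  polynomial identities in characteristic 2.\<close>

locale char_two =
  fixes F :: "'a::field itself"
  assumes two_zero: "(2::'a) = 0"
begin

declare two_zero [simp]

lemma add_self [simp]: "x + x = (0::'a)"
  using two_zero by (metis mult_2 mult_zero_left)

lemma add_self_left [simp]: "x + (x + y) = (y::'a)"
  by (simp flip: add.assoc)

lemma uminus_eq [simp]: "- x = (x::'a)"
  by (metis add_self add_eq_0_iff)

lemma minus_eq_add: "x - y = x + (y::'a)"
  using diff_conv_add_uminus[of x y] by simp

lemma add_eq_0_iff_eq: "x + y = 0 \<longleftrightarrow> x = (y::'a)"
  using eq_iff_diff_eq_0[of x y] by (simp add: minus_eq_add)

lemma eq_add_iff: "x = y + z \<longleftrightarrow> x + y + (z::'a) = 0"
  by (simp add: add.assoc add_eq_0_iff_eq)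

lemma add_power_two_power: "(x + y) ^ 2 ^ n = x ^ 2 ^ n + (y::'a) ^ 2 ^ n"
proof (induction n)
  case (Suc n)
  have "(x + y) ^ 2 ^ Suc n = ((x + y) ^ 2 ^ n)\<^sup>2"
    by (simp add: power_mult[symmetric] mult.commute)
  also have "\<dots> = x ^ 2 ^ Suc n + y ^ 2 ^ Suc n"
    using two_zero by (simp add: Suc power2_sum power_mult[symmetric] mult.commute)
  finally show ?case .
qed simp

lemma abs_trace_add: "abs_trace h (x + y) = abs_trace h x + abs_trace h (y::'a)"
  by (simp add: abs_trace_def add_power_two_power sum.distrib)

lemma power2_sum_char_two: "(x + y)\<^sup>2 = x\<^sup>2 + (y::'a)\<^sup>2"
  using add_power_two_power[of x y 1] by simp

lemma power2_eq_iff_char_two: "x\<^sup>2 = y\<^sup>2 \<longleftrightarrow> x = (y::'a)"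
  by (metis add_eq_0_iff_eq power2_sum_char_two power_eq_0_iff zero_neq_numeral)

end

lemma abs_trace_0 [simp]: "abs_trace h 0 = (0::'a::field)"
  by (simp add: abs_trace_def power_0_left)

locale binary_field =
  fixes F :: "'a::{field,finite} itself" and h :: nat
  assumes card_field: "CARD('a) = 2 ^ h"

sublocale binary_field \<subseteq> char_two F
  by unfold_locales (rule two_eq_zero[OF card_field])

context binary_field
begin

abbreviation Tr :: "'a \<Rightarrow> 'a" where "Tr \<equiv> abs_trace h"

text \<open>Squaring shifts the summands of the trace cyclically because x^q = x, so the trace is a
  root of t^2 = t.\<close>

lemma Tr_cases: "Tr x = 0 \<or> Tr x = 1"
proof -
  have sq: "(\<Sum>i\<in>A. f i)\<^sup>2 = (\<Sum>i\<in>A. (f i)\<^sup>2)" if "finite A" for A :: "nat set" and f :: "nat \<Rightarrow> 'a"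
    using that by (induction A rule: finite_induct) (simp_all add: power2_sum_char_two)
  have "(Tr x)\<^sup>2 = (\<Sum>i<h. x ^ 2 ^ Suc i)"
    unfolding abs_trace_def by (simp add: sq power_mult[symmetric] mult.commute)
  moreover have "(\<Sum>i<h. x ^ 2 ^ Suc i) + x ^ 2 ^ 0 = (\<Sum>i<h. x ^ 2 ^ i) + x ^ 2 ^ h"
    using sum.lessThan_Suc[of "\<lambda>i. x ^ 2 ^ i" h] sum.lessThan_Suc_shift[of "\<lambda>i. x ^ 2 ^ i" h]
    by (simp only: add.commute)
  ultimately have "(Tr x)\<^sup>2 = Tr x"
    using finite_field_power_card[of x] by (simp add: abs_trace_def card_field)
  then show ?thesis
    by (simp add: power2_eq_square)
qed

text \<open>As a polynomial function the trace has degree at most q/2, so it cannot vanish at all q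
  elements.\<close>

lemma ex_Tr_nonzero: "\<exists>x. Tr x \<noteq> 0"
proof (rule ccontr)
  assume "\<not> ?thesis"
  then have zero: "Tr x = 0" for x by blast
  have h: "h \<noteq> 0"
  proof
    assume "h = 0"
    then have "CARD('a) = 1" using card_field by simp
    then show False by (metis card_1_singletonE UNIV_I singletonD zero_neq_one)
  qed
  define p :: "'a poly" where "p = (\<Sum>i<h. monom 1 (2 ^ i))"
  \<comment> \<open>The linear coefficient comes from i = 0, the only index with 2^i = 1.\<close>
  have "coeff p 1 = 1"
    using h by (simp add: p_def coeff_sum if_distrib sum.delta' cong: if_cong)
  then have "p \<noteq> 0" by auto
  have "degree p \<le> 2 ^ (h - 1)"
    unfolding p_def by (intro degree_sum_le) (auto intro!: order_trans[OF degree_monom_le])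
  have "poly p x = 0" for x
    using zero[of x] by (simp add: p_def poly_sum poly_monom abs_trace_def)
  then have "card (UNIV::'a set) \<le> degree p"
    using card_poly_roots_bound[OF \<open>p \<noteq> 0\<close>] by simp
  also have "\<dots> \<le> 2 ^ (h - 1)" by fact
  also have "\<dots> < 2 ^ h" using h by simp
  finally show False using card_field by simp
qed

text \<open>If Tr(ax) = 1 forced Tr(bx) = 1, adding a point where both are 1 would make the two
  functionals agree everywhere, so Tr((a+b)x) would vanish identically although a + b is
  invertible.\<close>

lemma ex_Tr_independent:
  assumes "a \<noteq> 0" "b \<noteq> 0" "a \<noteq> b"
  shows "\<exists>x. Tr (a * x) = 1 \<and> Tr (b * x) = 0"
proof (rule ccontr)
  assume "\<not> ?thesis"
  then have imp: "Tr (b * x) = 1" if "Tr (a * x) = 1" for x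
    using that Tr_cases by blast
  obtain y where "Tr y = 1" using ex_Tr_nonzero Tr_cases by blast
  then have w: "Tr (a * (y / a)) = 1" using assms(1) by simp
  have eq: "Tr (a * x) = Tr (b * x)" for x
  proof (rule ccontr)
    assume "Tr (a * x) \<noteq> Tr (b * x)"
    then have "Tr (a * x) = 0" "Tr (b * x) = 1"
      using imp Tr_cases by metis+
    then have "Tr (a * (x + y / a)) = 1" "Tr (b * (x + y / a)) = 0"
      using w imp[OF w] by (simp_all add: distrib_left abs_trace_add)
    then show False using imp by fastforce
  qed
  have ab: "a + b \<noteq> 0" using assms by (simp add: add_eq_0_iff_eq)
  have "Tr ((a + b) * x) = 0" for x
    using eq by (simp add: distrib_right abs_trace_add)
  then have "Tr ((a + b) * (x / (a + b))) = 0" for x by blast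
  then show False using ab ex_Tr_nonzero by simp
qed

text \<open>The pair of traces maps onto F_2^2, and translation by a preimage \<open>w\<close> of
  (c, d) matches its fibre with the kernel. The product form also records that 4 divides q.\<close>

lemma card_Tr_class:
  assumes "a \<noteq> 0" "b \<noteq> 0" "a \<noteq> b" "c \<in> {0, 1}" "d \<in> {0, 1}"
  shows "4 * card {x. Tr (a * x) = c \<and> Tr (b * x) = d} = CARD('a)"
proof -
  define K where "K c d = {x. Tr (a * x) = c \<and> Tr (b * x) = d}" for c d
  obtain u where u: "Tr (a * u) = 1" "Tr (b * u) = 0"
    using ex_Tr_independent assms by blast
  obtain v where v: "Tr (b * v) = 1" "Tr (a * v) = 0"
    using ex_Tr_independent[of b a] assms by blast
  have shift: "card (K c d) = card (K 0 0)" if "c \<in> {0, 1}" "d \<in> {0, 1}" for c d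
  proof -
    define w where "w = c * u + d * v"
    have w: "Tr (a * w) = c" "Tr (b * w) = d"
      using that u v by (auto simp: w_def algebra_simps abs_trace_add)
    have "bij_betw (\<lambda>x. x + w) (K c d) (K 0 0)"
      by (rule bij_betw_byWitness[of _ "\<lambda>x. x + w"])
        (auto simp: K_def distrib_left abs_trace_add w add.assoc)
    then show ?thesis by (rule bij_betw_same_card)
  qed
  have UN: "UNIV = (K 0 0 \<union> K 0 1) \<union> (K 1 0 \<union> K 1 1)"
    unfolding K_def using Tr_cases by blast
  have "(K 0 0 \<union> K 0 1) \<inter> (K 1 0 \<union> K 1 1) = {}" "K 0 0 \<inter> K 0 1 = {}" "K 1 0 \<inter> K 1 1 = {}"
    unfolding K_def by fastforce+
  then have "CARD('a) = (card (K 0 0) + card (K 0 1)) + (card (K 1 0) + card (K 1 1))"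
    by (subst UN) (simp only: card_Un_disjoint[OF finite finite])
  also have "\<dots> = 4 * card (K c d)"
  proof -
    have "card (K 0 1) = card (K 0 0)" "card (K 1 0) = card (K 0 0)" "card (K 1 1) = card (K 0 0)"
      by (rule shift; simp)+
    then show ?thesis using shift[OF assms(4,5)] by linarith
  qed
  finally show ?thesis unfolding K_def by (rule sym)
qed

end

section \<open>Seventh roots of unity and the field with eight elements\<close>

lemma (in char_two) cube_cases:
  assumes "x ^ 7 = 1" "x \<noteq> (1::'a)"
  shows "x ^ 3 = x + 1 \<or> x ^ 3 = x\<^sup>2 + 1"
proof -
  \<comment> \<open>The factorisation of x^7 + 1 over F_2 into irreducible polynomials.\<close>
  have "(x + 1) * ((x ^ 3 + x + 1) * (x ^ 3 + x\<^sup>2 + 1)) = x ^ 7 + 1"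
    by (simp add: algebra_simps eval_nat_numeral)
  then have "(x + 1) * ((x ^ 3 + x + 1) * (x ^ 3 + x\<^sup>2 + 1)) = 0"
    using assms(1) by simp
  then have "x ^ 3 + x + 1 = 0 \<or> x ^ 3 + x\<^sup>2 + 1 = 0"
    using assms(2) by (simp add: add_eq_0_iff_eq)
  then show ?thesis by (simp add: add.assoc add_eq_0_iff_eq)
qed

text \<open>The unit group has prime order 7, so every element other than 1 generates it.\<close>

lemma power_7_generates:
  fixes x :: "'a::{field,finite}"
  assumes "CARD('a) = 8" "x \<noteq> 0" "x \<noteq> 1" "y \<noteq> 0"
  obtains k where "k < 7" "y = x ^ k"
proof -
  have "x ^ 8 = x" using finite_field_power_card[of x] assms(1) by simp
  then have x7: "x ^ 7 = 1" using assms(2) by (simp add: eval_nat_numeral)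
  have ne1: "x ^ n \<noteq> 1" if "0 < n" "n < 7" for n
  proof
    assume n: "x ^ n = 1"
    have "n = 1 \<or> n = 2 \<or> n = 3 \<or> n = 4 \<or> n = 5 \<or> n = 6" using that by auto
    moreover have False if "n * i = Suc (7 * j)" for i j
    proof -
      have "x ^ (n * i) = 1" "x ^ (7 * j) = 1" using n x7 by (simp_all add: power_mult)
      then show False using that assms(3) by simp
    qed
    \<comment> \<open>The first arguments are the inverses of 1, ..., 6 modulo 7; raising x^n = 1 to
      the matching one would give x = 1.\<close>
    from this[of 1 0] this[of 4 1] this[of 5 2] this[of 2 1] this[of 3 2] this[of 6 5]
    have "n \<notin> {1, 2, 3, 4, 5, 6}" by auto
    ultimately show False by blast
  qed
  have ne: "x ^ i \<noteq> x ^ j" if "i < j" "j < 7" for i j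
  proof
    assume "x ^ i = x ^ j"
    moreover have "x ^ j = x ^ i * x ^ (j - i)" using that by (simp flip: power_add)
    ultimately have "x ^ (j - i) = 1" using assms(2) by simp
    then show False using ne1[of "j - i"] that by simp
  qed
  have "inj_on (\<lambda>k. x ^ k) {..<7}"
    using ne by (intro linorder_inj_onI) auto
  then have "card ((\<lambda>k. x ^ k) ` {..<7}) = 7" by (simp add: card_image)
  moreover have "0 \<notin> (\<lambda>k. x ^ k) ` {..<7}" using assms(2) by auto
  ultimately have "card (insert 0 ((\<lambda>k. x ^ k) ` {..<7})) = CARD('a)" using assms(1) by simp
  then have "insert 0 ((\<lambda>k. x ^ k) ` {..<7}) = UNIV" by (intro card_subset_eq) auto
  then have "y \<in> insert 0 ((\<lambda>k. x ^ k) ` {..<7})" by simp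
  then show thesis using assms(4) that by auto
qed

context binary_field
begin

lemma field_sqrt_square: "(field_sqrt b)\<^sup>2 = (b::'a)"
proof -
  have "inj (\<lambda>x::'a. x\<^sup>2)" by (rule injI) (simp add: power2_eq_iff_char_two)
  then have "surj (\<lambda>x::'a. x\<^sup>2)" by (rule finite_UNIV_inj_surj[OF finite])
  then obtain s where s: "b = s\<^sup>2" by (rule surjE)
  have "\<exists>!s. s\<^sup>2 = b" unfolding s by (intro ex1I[of _ s]) (simp_all add: power2_eq_iff_char_two)
  then show ?thesis unfolding field_sqrt_def by (rule theI')
qed

end

section \<open>Ternary sums over four indices\<close>

lemma fourth_element:
  assumes "card K = 4" "i \<in> K" "j \<in> K" "k \<in> K" "distinct [i, j, k]"
  obtains l where "K = {i, j, k, l}" "distinct [i, j, k, l]"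
proof -
  have "finite K" using assms(1) by (auto intro: card_ge_0_finite)
  then have "card (K - {i, j, k}) = 1"
    using assms by (subst card_Diff_subset) auto
  then obtain l where l: "K - {i, j, k} = {l}" by (auto simp: card_1_singleton_iff)
  show thesis by (rule that[of l]) (use l assms in auto)
qed

context char_two
begin

text \<open>The index \<open>l\<close> is fixed before \<open>t\<close>, so that one and the same
  piece serves the affine parameter and both trace labels. For distinct indices it is the fourth
  one; if two coincide they cancel.\<close>

lemma four_element_ternary_sum:
  assumes "card K = 4" "i \<in> K" "j \<in> K" "k \<in> K"
  obtains l where "l \<in> K" "\<And>t :: 'i \<Rightarrow> 'a. sum t K = 0 \<Longrightarrow> t k + (t j + t i) = t l"
proof (cases "distinct [i, j, k]")
  case True
  obtain l where l: "K = {i, j, k, l}" "distinct [i, j, k, l]"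
    using fourth_element[OF assms True] .
  show thesis
  proof (rule that)
    show "l \<in> K" using l by simp
    fix t :: "'i \<Rightarrow> 'a" assume "sum t K = 0"
    then have "t i + (t j + (t k + t l)) = 0" using l by simp
    then have "(t k + (t j + t i)) + t l = 0" by (simp only: add_ac)
    then show "t k + (t j + t i) = t l" by (simp only: add_eq_0_iff_eq)
  qed
next
  case False
  then have "i = j \<or> i = k \<or> j = k" by auto
  then show thesis
  proof (elim disjE)
    assume "i = j" then show thesis using that[OF assms(4)] by simp
  next
    assume "i = k" then show thesis using that[OF assms(3)] by (simp add: add.commute)
  next
    assume "j = k" then show thesis using that[OF assms(2)] by simp
  qed
qed

text \<open>A sum of three distinct values cannot be one of them, since the other two would then
  agree; so it is the fourth value.\<close>

lemma translation_invariant_sum_zero: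
  fixes t :: "'i \<Rightarrow> 'a"
  assumes K: "card K = 4" and inj: "inj_on t K"
    and inv: "\<And>i j k. i \<in> K \<Longrightarrow> j \<in> K \<Longrightarrow> k \<in> K \<Longrightarrow> t k + (t j + t i) \<in> t ` K"
  shows "sum t K = 0"
proof -
  obtain T where "T \<subseteq> K" "card T = 3"
    using obtain_subset_with_card_n[of 3 K] K by auto
  then obtain i j k where ijk: "i \<in> K" "j \<in> K" "k \<in> K" "distinct [i, j, k]"
    unfolding card_3_iff by auto
  obtain l where l: "K = {i, j, k, l}" "distinct [i, j, k, l]"
    using fourth_element[OF K ijk] .
  have ne: "t i \<noteq> t j" "t i \<noteq> t k" "t j \<noteq> t k"
    using inj ijk by (auto simp: inj_on_eq_iff)
  obtain m where m: "m \<in> K" "t k + (t j + t i) = t m" using inv[OF ijk(1-3)] by auto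
  then have zero: "t i + (t j + (t k + t m)) = 0"
    by (metis add_self add.assoc add.commute)
  have "m \<noteq> i" using zero ne(3) by (auto simp: add_eq_0_iff_eq add.left_commute[of "t i"])
  moreover have "m \<noteq> j" using zero ne(2) by (auto simp: add_eq_0_iff_eq add.left_commute[of "t j"])
  moreover have "m \<noteq> k" using zero ne(1) by (auto simp: add_eq_0_iff_eq)
  ultimately have "m = l" using m(1) l(1) by blast
  then show ?thesis using zero l by simp
qed

end

lemma sum_less_5_minus:
  fixes f :: "nat \<Rightarrow> 'a::comm_monoid_add"
  shows "sum f ({..<5} - {0}) = f 1 + (f 2 + (f 3 + f 4))"
    "sum f ({..<5} - {1}) = f 0 + (f 2 + (f 3 + f 4))"
    "sum f ({..<5} - {2}) = f 0 + (f 1 + (f 3 + f 4))"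
    "sum f ({..<5} - {3}) = f 0 + (f 1 + (f 2 + f 4))"
    "sum f ({..<5} - {4}) = f 0 + (f 1 + (f 2 + f 3))"
proof -
  have "{..<5} - {0} = {1, 2, 3, 4::nat}" "{..<5} - {1} = {0, 2, 3, 4::nat}"
    "{..<5} - {2} = {0, 1, 3, 4::nat}" "{..<5} - {3} = {0, 1, 2, 4::nat}"
    "{..<5} - {4} = {0, 1, 2, 3::nat}" by auto
  then show "sum f ({..<5} - {0}) = f 1 + (f 2 + (f 3 + f 4))"
    "sum f ({..<5} - {1}) = f 0 + (f 2 + (f 3 + f 4))"
    "sum f ({..<5} - {2}) = f 0 + (f 1 + (f 3 + f 4))"
    "sum f ({..<5} - {3}) = f 0 + (f 1 + (f 2 + f 4))"
    "sum f ({..<5} - {4}) = f 0 + (f 1 + (f 2 + f 3))"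
    by (simp_all only:) simp_all
qed

section \<open>Points, lines and elations of the projective plane\<close>

lemma vector_3_eq_iff: "vector [x, y, z] = (v :: 'a::zero ^ 3) \<longleftrightarrow> x = v $ 1 \<and> y = v $ 2 \<and> z = v $ 3"
  by (simp add: vec_eq_iff forall_3)

lemma vector_3_eq_0_iff: "vector [x, y, z] = (0 :: 'a::zero ^ 3) \<longleftrightarrow> x = 0 \<and> y = 0 \<and> z = 0"
  by (simp add: vector_3_eq_iff)

section \<open>Lines as kernels of linear forms\<close>

definition lform :: "'a::field ^ 3 \<Rightarrow> 'a ^ 3 \<Rightarrow> 'a" where
  "lform a v = a $ 1 * v $ 1 + a $ 2 * v $ 2 + a $ 3 * v $ 3"

text \<open>Lines in dual coordinates. For \<open>a = 0\<close> this would be the whole plane, hence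
  the recurring assumption \<open>a \<noteq> 0\<close>.\<close>

definition line_of :: "'a::field ^ 3 \<Rightarrow> ('a ^ 3) set set" where
  "line_of a = {P \<in> pg_points. P \<subseteq> {v. lform a v = 0}}"

lemma lform_add: "lform a (u + v) = lform a u + lform a v"
  and lform_diff: "lform a (u - v) = lform a u - lform a v"
  and lform_scale: "lform a (c *s v) = c * lform a v"
  and lform_zero [simp]: "lform a 0 = 0"
  by (simp_all add: lform_def algebra_simps)

lemmas lform_linear = lform_add lform_diff lform_scale

lemma subspace_lform: "vec.subspace {v. lform a v = 0}"
  by (simp add: vec.subspace_def lform_linear)

text \<open>The kernel together with one vector outside it spans the space, so its dimension is 3 -
  1.\<close>

lemma dim_lform:
  fixes a :: "'a::field ^ 3"
  assumes "a \<noteq> 0"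
  shows "vec.dim {v. lform a v = 0} = 2"
proof -
  define K where "K = {v. lform a v = 0}"
  obtain i where i: "a $ i \<noteq> 0" using assms by (auto simp: vec_eq_iff)
  define w :: "'a ^ 3" where "w = axis i 1"
  have "lform a w = a $ i"
    using exhaust_3[of i] by (auto simp: lform_def w_def axis_def)
  then have w: "lform a w \<noteq> 0" using i by simp
  have spK: "vec.span K = K"
    unfolding K_def by (simp add: subspace_lform)
  have "v \<in> vec.span (insert w K)" for v
  proof -
    have "v - (lform a v / lform a w) *s w \<in> K"
      using w by (simp add: K_def lform_linear)
    then show ?thesis
      unfolding vec.span_insert spK by blast
  qed
  then have "vec.span (insert w K) = UNIV" by blast
  then have "vec.dim (insert w K) = 3"
    using vec.dim_span[of "insert w K"] vec_dim_card[where 'a = 'a and 'n = 3]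
    by (simp del: vec.dim_UNIV vec.dim_span)
  moreover have "w \<notin> vec.span K" unfolding spK using w by (simp add: K_def)
  ultimately show ?thesis
    by (simp add: vec.dim_insert K_def)
qed

lemma span_singleton_subset_iff:
  assumes "vec.subspace W"
  shows "vec.span {v} \<subseteq> W \<longleftrightarrow> v \<in> W"
  using vec.span_minimal[OF _ assms, of "{v}"] vec.span_base[of v "{v}"] by blast

text \<open>The matrix with rows u, v and 0 is singular, also when u and v are dependent, and a
  kernel vector is the required form. This supplies joining lines.\<close>

lemma ex_lform_zero2:
  fixes u v :: "'a::field ^ 3"
  shows "\<exists>a. a \<noteq> 0 \<and> lform a u = 0 \<and> lform a v = 0"
proof -
  define M :: "'a ^ 3 ^ 3" where "M = vector [u, v, 0]"
  have "det M = 0"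
    by (simp add: M_def det_3)
  then have "\<not> invertible M" by (simp add: invertible_det_nz)
  then obtain a where "M *v a = 0" "a \<noteq> 0"
    using invertible_left_inverse matrix_left_invertible_ker by blast
  moreover from this(1) have "(M *v a) $ 1 = 0" "(M *v a) $ 2 = 0" by simp_all
  then have "lform a u = 0" "lform a v = 0"
    unfolding lform_def matrix_vector_mult_def M_def by (simp_all add: sum_3 mult.commute)
  ultimately show ?thesis by blast
qed

lemma lform_zero_imp_span:
  assumes "a \<noteq> 0" "p \<noteq> 0" "q \<notin> vec.span {p}"
    and "lform a p = 0" "lform a q = 0" "lform a y = 0"
  shows "\<exists>s t. y = s *s p + t *s q"
proof -
  have "vec.dim (vec.span {q, p}) = 2"
    using assms(2,3) by (simp add: vec.dim_insert)
  moreover have "vec.span {q, p} \<subseteq> {v. lform a v = 0}"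
    by (rule vec.span_minimal) (use assms subspace_lform in auto)
  ultimately have "vec.span {q, p} = {v. lform a v = 0}"
    using dim_lform[OF assms(1)] by (intro vec.subspace_dim_equal) (auto simp: subspace_lform)
  then have "y \<in> vec.span {q, p}" using assms(6) by simp
  then obtain t s where "y - t *s q = s *s p"
    by (auto simp: vec.span_insert)
  then have "y = s *s p + t *s q" by (simp add: algebra_simps)
  then show ?thesis by blast
qed

lemma pg_points_iff: "P \<in> pg_points \<longleftrightarrow> (\<exists>v. v \<noteq> 0 \<and> P = vec.span {v})"
proof
  assume P: "P \<in> pg_points"
  then obtain B where B: "B \<subseteq> P" "vec.independent B" "P \<subseteq> vec.span B" "card B = 1"
    unfolding pg_points_def by (metis (mono_tags, lifting) mem_Collect_eq vec.basis_exists)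
  then obtain v where v: "B = {v}" by (meson card_1_singletonE)
  have "vec.subspace P" using P by (simp add: pg_points_def)
  then have "P = vec.span {v}"
    using B v by (intro subset_antisym) (simp_all add: span_singleton_subset_iff)
  moreover have "v \<noteq> 0" using B(2) v vec.dependent_zero by blast
  ultimately show "\<exists>v. v \<noteq> 0 \<and> P = vec.span {v}" by blast
next
  assume "\<exists>v. v \<noteq> 0 \<and> P = vec.span {v}"
  then show "P \<in> pg_points" by (auto simp: pg_points_def)
qed

lemma span_in_points: "v \<noteq> 0 \<Longrightarrow> vec.span {v} \<in> pg_points"
  using pg_points_iff by blast

lemma pg_lines_eq: "pg_lines = {line_of a | a :: 'a::field ^ 3. a \<noteq> 0}"
proof (intro set_eqI iffI)
  fix l :: "('a ^ 3) set set"
  assume "l \<in> pg_lines"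
  then obtain L where L: "vec.subspace L" "vec.dim L = 2" "l = {P \<in> pg_points. P \<subseteq> L}"
    unfolding pg_lines_def by blast
  obtain B where B: "B \<subseteq> L" "L \<subseteq> vec.span B" "card B = 2"
    using vec.basis_exists[of L] L(2) by metis
  then obtain u v where uv: "B = {u, v}" by (meson card_2_iff)
  obtain a where a: "a \<noteq> 0" "lform a u = 0" "lform a v = 0"
    using ex_lform_zero2 by blast
  have "vec.span B \<subseteq> {v. lform a v = 0}"
    by (rule vec.span_minimal) (use a uv subspace_lform in auto)
  then have "L \<subseteq> {v. lform a v = 0}" using B by blast
  then have "L = {v. lform a v = 0}"
    using L dim_lform[OF a(1)] subspace_lform by (intro vec.subspace_dim_equal) auto
  then show "l \<in> {line_of a | a. a \<noteq> 0}"
    using L(3) a(1) by (auto simp: line_of_def)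
next
  fix l :: "('a ^ 3) set set"
  assume "l \<in> {line_of a | a. a \<noteq> 0}"
  then show "l \<in> pg_lines"
    unfolding pg_lines_def line_of_def using dim_lform subspace_lform by blast
qed

lemma span_in_line_of: "v \<noteq> 0 \<Longrightarrow> vec.span {v} \<in> line_of a \<longleftrightarrow> lform a v = 0"
  by (simp add: line_of_def span_in_points span_singleton_subset_iff[OF subspace_lform])

lemma span_singleton_eq_iff:
  assumes "u \<noteq> 0" "v \<noteq> 0"
  shows "vec.span {u} = vec.span {v} \<longleftrightarrow> (\<exists>c. c \<noteq> 0 \<and> v = c *s u)"
proof
  assume "vec.span {u} = vec.span {v}"
  then have "v \<in> vec.span {u}" by (simp add: vec.span_base)
  then obtain c where "v = c *s u" by (auto simp: vec.span_singleton)
  with assms show "\<exists>c. c \<noteq> 0 \<and> v = c *s u" by auto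
next
  assume "\<exists>c. c \<noteq> 0 \<and> v = c *s u"
  then obtain c where c: "c \<noteq> 0" "v = c *s u" by blast
  then have "u = (1 / c) *s v" by simp
  then show "vec.span {u} = vec.span {v}"
    using c(2) vec.span_scale[OF vec.span_base[of u "{u}"], of c]
      vec.span_scale[OF vec.span_base[of v "{v}"], of "1 / c"]
    by (intro subset_antisym) (simp_all add: span_singleton_subset_iff del: vec.span_insert)
qed

lemma span_scale_eq: "c \<noteq> 0 \<Longrightarrow> vec.span {c *s v} = vec.span {v :: 'a::field ^ 3}"
  by (cases "v = 0") (auto simp: span_singleton_eq_iff intro: exI[of _ "1 / c"])

section \<open>Affine coordinates off a line, and elations as translations\<close>

lemma normalized_representative:
  assumes "P \<in> pg_points" "P \<notin> line_of a"
  obtains v where "P = vec.span {v}" "lform a v = 1"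
proof -
  obtain w where w: "w \<noteq> 0" "P = vec.span {w}" using assms pg_points_iff by blast
  then have "lform a w \<noteq> 0" using assms span_in_line_of by blast
  then show thesis
    using w that[of "(1 / lform a w) *s w"] by (simp add: span_scale_eq lform_scale)
qed

text \<open>The points off \<open>line_of a\<close> thus correspond to the vectors on the affine
  plane \<open>lform a = 1\<close>; elations are computed there.\<close>

lemma normalized_representative_unique:
  assumes "vec.span {u} = vec.span {v}" "lform a u = 1" "lform a v = 1"
  shows "u = v"
proof -
  have "u \<noteq> 0" "v \<noteq> 0" using assms by auto
  then obtain c where "v = c *s u" using assms(1) span_singleton_eq_iff by blast
  then show ?thesis using assms by (simp add: lform_scale)
qed

lemma line_of_scale: "e \<noteq> 0 \<Longrightarrow> line_of (e *s a) = line_of (a :: 'a::field ^ 3)"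
  by (simp add: line_of_def lform_def mult.assoc flip: distrib_left)

lemma lform_vector: "lform a (vector [x, y, z]) = a $ 1 * x + a $ 2 * y + a $ 3 * z"
  by (simp add: lform_def)

text \<open>The line joining a point to the centre is preserved, so the image differs from
  \<open>x\<close> by a multiple of the centre \<open>c\<close>. That multiple may still depend on
  \<open>x\<close> here; its constancy needs a second line.\<close>

lemma elation_normalized:
  assumes el: "elation (line_of a) f"
  obtains c where "c \<noteq> 0" "lform a c = 0"
    "\<And>x. lform a x = 1 \<Longrightarrow> \<exists>t. f (vec.span {x}) = vec.span {x + t *s c}"
proof -
  from el have bij: "bij_betw f pg_points pg_points"
    and fix_axis: "\<And>P. P \<in> line_of a \<Longrightarrow> f P = P"
    unfolding elation_def collineation_def by blast+
  from el have "\<exists>C\<in>line_of a. \<forall>m\<in>pg_lines. C \<in> m \<longrightarrow> f ` m = m"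
    by (simp only: elation_def)
  then obtain C where C: "C \<in> line_of a" "\<forall>m\<in>pg_lines. C \<in> m \<longrightarrow> f ` m = m"
    by (rule bexE)
  have "C \<in> pg_points" using C(1) by (simp add: line_of_def)
  then obtain c where c: "c \<noteq> 0" "C = vec.span {c}"
    using pg_points_iff by blast
  then have ac: "lform a c = 0" using C(1) span_in_line_of by blast
  have "\<exists>t. f (vec.span {x}) = vec.span {x + t *s c}" if x: "lform a x = 1" for x
  proof -
    have x0: "x \<noteq> 0" using x by auto
    have "f (vec.span {x}) \<in> pg_points"
      using bij x0 by (auto simp: bij_betw_def span_in_points)
    \<comment> \<open>A point of the axis is already its own image, so injectivity keeps other
      points off the axis.\<close>
    moreover have "f (vec.span {x}) \<notin> line_of a"
    proof
      assume *: "f (vec.span {x}) \<in> line_of a"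
      then have "f (f (vec.span {x})) = f (vec.span {x})" by (rule fix_axis)
      then have "f (vec.span {x}) = vec.span {x}"
        using bij_betw_imp_inj_on[OF bij] x0 *
        by (simp add: inj_on_eq_iff span_in_points line_of_def)
      then show False using * x x0 span_in_line_of[of x a] by simp
    qed
    ultimately obtain y where y: "f (vec.span {x}) = vec.span {y}" "lform a y = 1"
      by (rule normalized_representative)
    obtain b where b: "b \<noteq> 0" "lform b x = 0" "lform b c = 0"
      using ex_lform_zero2 by blast
    have m: "f ` line_of b = line_of b"
      by (rule C(2)[rule_format]) (use b c pg_lines_eq span_in_line_of in auto)
    have "vec.span {x} \<in> line_of b" using b x0 span_in_line_of by blast
    then have "f (vec.span {x}) \<in> line_of b" using m by blast
    then have "lform b y = 0" using y span_in_line_of[of y b] by fastforce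
    moreover have "x \<notin> vec.span {c}"
      using x ac by (auto simp: vec.span_singleton lform_scale)
    ultimately obtain s t where st: "y = s *s c + t *s x"
      using lform_zero_imp_span[of b c x y] b c by blast
    then have "t = 1" using y(2) x ac by (simp add: lform_linear)
    then show ?thesis using y(1) st by (auto simp: add.commute)
  qed
  then show thesis using that c ac by blast
qed

text \<open>The image of \<open>x\<close> is the intersection of the line joining \<open>x\<close> to the centre with the line
  joining the image of \<open>u\<close> to the axis point \<open>x - u\<close>.\<close>

lemma elation_translation_aux:
  assumes el: "elation (line_of a) f"
    and u: "lform a u = 1" and x: "lform a x = 1"
    and s: "f (vec.span {u}) = vec.span {u + s *s c}"
    and t: "f (vec.span {x}) = vec.span {x + t *s c}"
    and c: "lform a c = 0" "x - u \<notin> vec.span {c}"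
  shows "f (vec.span {x}) = vec.span {x + s *s c}"
proof -
  have D: "x - u \<noteq> 0" using c(2) vec.span_zero by metis
  have aD: "lform a (x - u) = 0" using u x by (simp add: lform_linear)
  have nz: "u \<noteq> 0" "x \<noteq> 0" "u + s *s c \<noteq> 0" "x + t *s c \<noteq> 0"
    using u x c(1) by (auto simp: lform_linear dest!: arg_cong[where f = "lform a"])
  obtain b where b: "b \<noteq> 0" "lform b (x - u) = 0" "lform b u = 0"
    using ex_lform_zero2 by blast
  have "image f ` pg_lines = pg_lines"
    using el by (auto simp: elation_def collineation_def bij_betw_def)
  then have "f ` line_of b \<in> pg_lines" using b(1) pg_lines_eq by blast
  then obtain b' where b': "b' \<noteq> 0" "f ` line_of b = line_of b'" using pg_lines_eq by blast
  have "vec.span {x - u} \<in> line_of b" "vec.span {u} \<in> line_of b" "vec.span {x} \<in> line_of b"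
    using b D nz by (auto simp: span_in_line_of lform_diff)
  then have "f (vec.span {x - u}) \<in> line_of b'" "f (vec.span {u}) \<in> line_of b'"
    "f (vec.span {x}) \<in> line_of b'"
    using b'(2) by blast+
  moreover have "f (vec.span {x - u}) = vec.span {x - u}"
    using el D aD by (auto simp: elation_def span_in_line_of)
  ultimately have "lform b' (x - u) = 0" "lform b' (u + s *s c) = 0" "lform b' (x + t *s c) = 0"
    using s t D nz by (simp_all add: span_in_line_of)
  \<comment> \<open>Independent because \<open>lform a\<close> is 1 on one vector and 0 on the
    other; the image of \<open>x\<close> lies on the line through both.\<close>
  moreover have "u + s *s c \<notin> vec.span {x - u}"
    using u aD c(1) by (auto simp: vec.span_singleton lform_linear dest!: arg_cong[where f = "lform a"])
  ultimately obtain p r where pr: "x + t *s c = p *s (x - u) + r *s (u + s *s c)"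
    using lform_zero_imp_span[OF b'(1) D] by blast
  \<comment> \<open>Evaluating \<open>lform a\<close> gives r = 1; what remains is a linear relation
    between \<open>x - u\<close> and \<open>c\<close>, which are independent.\<close>
  then have "r = 1"
    using u x c(1) by (auto simp: lform_linear dest!: arg_cong[where f = "lform a"])
  with pr have eq: "(1 - p) *s (x - u) = (s - t) *s c"
    by (simp add: vec_eq_iff algebra_simps)
  have "p = 1"
  proof (rule ccontr)
    assume "p \<noteq> 1"
    then obtain k where k: "k * (1 - p) = 1" by (metis nonzero_divide_eq_eq right_minus_eq)
    have "x - u = (k * (1 - p)) *s (x - u)" unfolding k by simp
    also have "\<dots> = k *s ((s - t) *s c)"
      by (simp only: vec.scale_scale[symmetric] eq)
    finally have "x - u \<in> vec.span {c}" by (metis vec.span_base vec.span_scale singletonI)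
    then show False using c(2) by blast
  qed
  then have "(s - t) *s c = 0" using eq by simp
  then have "t *s c = s *s c" by auto
  then show ?thesis using t by (simp only:)
qed

text \<open>One pair of corresponding points determines the elation. The previous construction
  degenerates when \<open>x\<close> lies on the line joining \<open>u\<close> to the centre.\<close>

lemma elation_translation:
  assumes a: "a \<noteq> 0" and el: "elation (line_of a) f"
    and uv: "lform a u = 1" "lform a v = 1" "f (vec.span {u}) = vec.span {v}"
    and x: "lform a x = 1"
  shows "f (vec.span {x}) = vec.span {x + v - u}"
proof -
  obtain c where c: "c \<noteq> 0" "lform a c = 0"
    and ct: "\<And>x. lform a x = 1 \<Longrightarrow> \<exists>t. f (vec.span {x}) = vec.span {x + t *s c}"
    using elation_normalized[OF el] by blast
  obtain s where s: "f (vec.span {u}) = vec.span {u + s *s c}" using ct uv by blast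
  have v: "v = u + s *s c"
    by (rule normalized_representative_unique[of _ _ a]) (use s uv c in \<open>simp_all add: lform_linear\<close>)
  have far: "f (vec.span {y}) = vec.span {y + s *s c}"
    if "lform a y = 1" "lform a z = 1" "y - z \<notin> vec.span {c}"
      "f (vec.span {z}) = vec.span {z + s *s c}" for y z
    using elation_translation_aux[OF el] that c ct by blast
  have "f (vec.span {x}) = vec.span {x + s *s c}"
  proof (cases "x - u \<in> vec.span {c}")
    case False
    then show ?thesis using far x uv s by blast
  next
    case True
    \<comment> \<open>Detour through a point off the line joining \<open>u\<close> to the centre.\<close>
    have "\<not> {v. lform a v = 0} \<subseteq> vec.span {c}"
      using vec.dim_subset[of "{v. lform a v = 0}" "vec.span {c}"] dim_lform[OF a] by (auto split: if_splits)
    then obtain d where d: "lform a d = 0" "d \<notin> vec.span {c}" by blast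
    have 1: "f (vec.span {u + d}) = vec.span {u + d + s *s c}"
      by (rule far[of _ u]) (use d uv s in \<open>simp_all add: lform_linear\<close>)
    show ?thesis
    proof (rule far[OF x _ _ 1])
      show "lform a (u + d) = 1" using uv d by (simp add: lform_linear)
      show "x - (u + d) \<notin> vec.span {c}"
      proof
        assume "x - (u + d) \<in> vec.span {c}"
        then have "(x - u) - (x - (u + d)) \<in> vec.span {c}" using True vec.span_diff by blast
        then show False using d by simp
      qed
    qed
  qed
  then show ?thesis using v by (simp add: algebra_simps)
qed

text \<open>For \<open>lform a w = 0\<close> this is the transvection with axis
  \<open>line_of a\<close> and direction \<open>w\<close>; on vectors with
  \<open>lform a x = 1\<close> it is translation by \<open>w\<close>.\<close>

definition shear :: "'a::field ^ 3 \<Rightarrow> 'a ^ 3 \<Rightarrow> 'a ^ 3 \<Rightarrow> 'a ^ 3" where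
  "shear a w x = x + lform a x *s w"

lemma lform_shear: "lform a w = 0 \<Longrightarrow> lform a (shear a w x) = lform a x"
  by (simp add: shear_def lform_linear)

lemma shear_uminus:
  assumes "lform a w = 0"
  shows "shear a (- w) (shear a w x) = x"
proof -
  have "shear a (- w) (shear a w x) = shear a w x + lform a (shear a w x) *s (- w)"
    by (rule shear_def)
  also have "\<dots> = x"
    unfolding lform_shear[OF assms] by (simp only: shear_def vec.scale_minus_right add_uminus_conv_diff add_diff_cancel_right')
  finally show ?thesis .
qed

lemma shear_image_span: "shear a w ` vec.span {x} = vec.span {shear a w x}"
proof -
  have "shear a w (k *s x) = k *s shear a w x" for k
    by (simp add: shear_def lform_scale vec.scale_right_distrib)
  then show ?thesis unfolding vec.span_singleton image_image by simp
qed

lemma lform_uminus: "lform a (- v) = - lform a v"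
  by (simp add: lform_def)

lemma shear_image_uminus:
  assumes "lform a w = 0"
  shows "shear a (- w) ` shear a w ` P = P"
  using shear_uminus[OF assms] by (simp add: image_image)

lemma shear_image_points:
  assumes "lform a w = 0" "P \<in> pg_points"
  shows "shear a w ` P \<in> pg_points"
proof -
  obtain x where x: "x \<noteq> 0" "P = vec.span {x}" using assms(2) pg_points_iff by blast
  have "shear a w x \<noteq> 0"
    using shear_uminus[OF assms(1), of x] x(1) by (auto simp: shear_def)
  then show ?thesis using x(2) by (simp add: shear_image_span span_in_points)
qed

lemma shear_image_lines:
  assumes w: "lform a w = 0" and "m \<in> pg_lines"
  shows "(\<lambda>P. shear a w ` P) ` m \<in> pg_lines"
proof -
  obtain b where b: "b \<noteq> 0" "m = line_of b" using assms pg_lines_eq by blast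
  \<comment> \<open>\<open>b'\<close> is \<open>b\<close> composed with the inverse shear, so its
    kernel is the image of the kernel of \<open>b\<close>.\<close>
  define b' where "b' = b - lform b w *s a"
  have b'x: "lform b' x = lform b x - lform b w * lform a x" for x
    by (simp add: b'_def lform_def algebra_simps)
  have "b' \<noteq> 0"
  proof
    assume "b' = 0"
    then have "lform b' w = 0" by (simp add: lform_def)
    then have "lform b w = 0" using b'x[of w] w by simp
    then show False using b(1) \<open>b' = 0\<close> by (simp add: b'_def)
  qed
  have inv: "lform a (- w) = 0" using w by (simp add: lform_uminus)
  have "lform b' (shear a w x) = lform b x" for x
    using w by (simp add: b'x shear_def lform_linear)
  moreover have "lform b (shear a (- w) x) = lform b' x" for x
    by (simp add: b'x shear_def lform_linear lform_uminus)
  ultimately have "P \<in> line_of b \<Longrightarrow> shear a w ` P \<in> line_of b'"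
    and "P \<in> line_of b' \<Longrightarrow> shear a (- w) ` P \<in> line_of b" for P
    using shear_image_points[OF w, of P] shear_image_points[OF inv, of P]
    unfolding line_of_def by auto
  moreover have "shear a w ` shear a (- w) ` P = P" for P
    using shear_image_uminus[OF inv] by simp
  ultimately have "(\<lambda>P. shear a w ` P) ` m = line_of b'"
    unfolding b(2) by (intro set_eqI iffI; metis (no_types, lifting) image_iff)
  then show ?thesis using \<open>b' \<noteq> 0\<close> pg_lines_eq by blast
qed

text \<open>The centre is the point spanned by \<open>w\<close>, because a form vanishing at
  \<open>w\<close> is invariant under the shear.\<close>

lemma elation_shear:
  assumes a: "a \<noteq> 0" and w: "lform a w = 0"
  shows "elation (line_of a) (\<lambda>P. shear a w ` P)"
proof -
  let ?f = "\<lambda>w P. shear a w ` P"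
  have inv: "lform a (- w) = 0" using w by (simp add: lform_uminus)
  have id: "?f (- w) (?f w P) = P" "?f w (?f (- w) P) = P" for P
    using shear_image_uminus[OF w] shear_image_uminus[OF inv] by simp_all
  have coll: "collineation (?f w)"
    unfolding collineation_def
  proof
    show "bij_betw (?f w) pg_points pg_points"
      by (rule bij_betw_byWitness[of _ "?f (- w)"])
        (use id shear_image_points[OF w] shear_image_points[OF inv] in auto)
    show "bij_betw (image (?f w)) pg_lines pg_lines"
      by (rule bij_betw_byWitness[of _ "image (?f (- w))"])
        (use id shear_image_lines[OF w] shear_image_lines[OF inv] in \<open>auto simp: image_comp comp_def\<close>)
  qed
  have axis: "?f w P = P" if P: "P \<in> line_of a" for P
  proof -
    have "shear a w x = x" if "x \<in> P" for x
      using P that by (auto simp: line_of_def shear_def)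
    then show ?thesis by simp
  qed
  have centre: "\<exists>C\<in>line_of a. \<forall>m\<in>pg_lines. C \<in> m \<longrightarrow> ?f w ` m = m"
  proof -
    obtain c where c: "c \<noteq> 0" "lform a c = 0" "w \<in> vec.span {c}"
    \<comment> \<open>For \<open>w = 0\<close> the shear is the identity, and any point of the axis
      can be the centre.\<close>
    proof (cases "w = 0")
      case True
      obtain c where "c \<noteq> 0" "lform a c = 0"
        using ex_lform_zero2[of a a] by (auto simp: lform_def mult.commute)
      then show ?thesis using that True by (simp add: vec.span_zero)
    next
      case False
      then show ?thesis using that[of w] w by (simp add: vec.span_base)
    qed
    have "?f w ` m = m" if m: "m \<in> pg_lines" "vec.span {c} \<in> m" for m
    proof -
      obtain b where b: "m = line_of b" using m pg_lines_eq by blast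
      then have "lform b c = 0" using c m span_in_line_of by blast
      then have bw: "lform b w = 0" using c(3) by (auto simp: vec.span_singleton lform_scale)
      then have "lform b (shear a w x) = lform b x" "lform b (shear a (- w) x) = lform b x" for x
        by (simp_all add: shear_def lform_linear lform_uminus)
      then have "?f w P \<in> m" "?f (- w) P \<in> m" if "P \<in> m" for P
        using that shear_image_points[OF w] shear_image_points[OF inv]
        unfolding line_of_def b by auto
      then show ?thesis
        using id(2) by (intro set_eqI iffI; metis (no_types, lifting) image_iff)
    qed
    then show ?thesis using c span_in_line_of by blast
  qed
  show ?thesis
    unfolding elation_def by (intro conjI ballI coll axis centre)
qed

text \<open>Transitivity is reduced to a closure property of normalised vectors: the shear by v - u
  moves \<open>u\<close> to \<open>v\<close>.\<close>

lemma translation_setI: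
  assumes a: "a \<noteq> 0" and S: "S \<subseteq> pg_points"
    and closed: "\<And>u v x. \<lbrakk>lform a u = 1; vec.span {u} \<in> S; lform a v = 1; vec.span {v} \<in> S;
      lform a x = 1; vec.span {x} \<in> S\<rbrakk> \<Longrightarrow> vec.span {x + (v - u)} \<in> S"
  shows "translation_set (line_of a) S"
  unfolding translation_set_def
proof (intro ballI)
  have stable: "shear a (v - u) ` P \<in> S"
    if "lform a u = 1" "vec.span {u} \<in> S" "lform a v = 1" "vec.span {v} \<in> S" "P \<in> S" for u v P
  proof (cases "P \<in> line_of a")
    case True
    then have "shear a (v - u) ` P = P"
      using elation_shear[OF a, of "v - u"] that by (simp add: elation_def lform_diff)
    then show ?thesis using that by simp
  next
    case False
    with that S obtain x where x: "P = vec.span {x}" "lform a x = 1"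
      using normalized_representative by (metis subsetD)
    then have "shear a (v - u) ` P = vec.span {x + (v - u)}"
      by (simp only: shear_image_span) (simp add: shear_def)
    then show ?thesis using closed[of u v x] that x by simp
  qed
  fix P Q assume P: "P \<in> S - line_of a" and Q: "Q \<in> S - line_of a"
  obtain u where u: "P = vec.span {u}" "lform a u = 1"
    using normalized_representative P S by (metis DiffE subsetD)
  obtain v where v: "Q = vec.span {v}" "lform a v = 1"
    using normalized_representative Q S by (metis DiffE subsetD)
  define w where "w = v - u"
  have w: "lform a w = 0" using u v by (simp add: w_def lform_diff)
  then have inv: "lform a (- w) = 0" by (simp add: lform_uminus)
  have "(\<lambda>P. shear a w ` P) ` S \<subseteq> S"
    using stable[of u v] u v P Q by (auto simp: w_def)
  \<comment> \<open>Exchanging \<open>u\<close> and \<open>v\<close> gives the inverse shear, which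
    turns the inclusion into an equality.\<close>
  moreover have "(\<lambda>P. shear a (- w) ` P) ` S \<subseteq> S"
    using stable[of v u] u v P Q by (auto simp: w_def)
  moreover have "shear a w ` shear a (- w) ` P = P" for P
    using shear_image_uminus[OF inv] by simp
  ultimately have "(\<lambda>P. shear a w ` P) ` S = S"
    by (intro set_eqI iffI) (metis (no_types, lifting) image_iff subsetD)+
  moreover have "shear a w ` P = Q"
    using u v by (simp add: shear_image_span) (simp add: shear_def w_def)
  ultimately show "\<exists>f. elation (line_of a) f \<and> f ` S = S \<and> f P = Q"
    using elation_shear[OF a w] by blast
qed

section \<open>The KM-arc\<close>

locale km_parameters = binary_field F h for F :: "'a::{field,finite} itself" and h +
  fixes \<alpha> \<beta> :: 'a
  assumes \<alpha>: "\<alpha> \<noteq> 0" "\<alpha> \<noteq> 1" and \<beta>: "\<beta> \<noteq> 0" "\<beta> \<noteq> 1" and \<alpha>\<beta>: "\<alpha> * \<beta> \<noteq> 1"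
begin

definition \<gamma> :: 'a where "\<gamma> = km_gamma \<alpha> \<beta>"
definition \<xi> :: 'a where "\<xi> = km_xi \<alpha> \<beta>"

text \<open>Tables for the pieces 0 to 4, so that they can be treated uniformly in k:
  \<open>(Y k, Z k)\<close> selects the line through the nucleus, \<open>p k\<close> and
  \<open>r k\<close> are the multipliers inside the two traces, \<open>c k\<close> and
  \<open>d k\<close> the prescribed values.\<close>

definition Y :: "nat \<Rightarrow> 'a" where "Y k = [1, 0, 1, \<gamma>, \<beta> + 1] ! k"
definition Z :: "nat \<Rightarrow> 'a" where "Z k = [0, 1, 1, 1, 1] ! k"
definition p :: "nat \<Rightarrow> 'a" where "p k = [1, 1, 1, 1 / (\<alpha> * \<gamma>), 1 / (\<alpha> * \<beta>)] ! k"
definition r :: "nat \<Rightarrow> 'a" where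
  "r k = [1 / \<alpha>, 1 / (\<alpha> * \<gamma>), 1 / (\<alpha> * \<beta>), 1 / \<xi>, 1 / \<xi>] ! k"
definition c :: "nat \<Rightarrow> 'a" where "c k = [0, 0, 1, 1, 1] ! k"
definition d :: "nat \<Rightarrow> 'a" where "d k = [0, 0, 0, 1, 0] ! k"

definition part :: "nat \<Rightarrow> ('a ^ 3) set set" where
  "part k = {pg_point z (Y k) (Z k) | z. Tr (p k * z) = c k \<and> Tr (r k * z) = d k}"

lemmas data_defs = Y_def Z_def p_def r_def c_def d_def

lemma less_5_iff: "k < (5::nat) \<longleftrightarrow> k = 0 \<or> k = 1 \<or> k = 2 \<or> k = 3 \<or> k = 4"
  by auto

lemma Ex_less_5: "(\<exists>k<5::nat. P k) \<longleftrightarrow> P 0 \<or> P 1 \<or> P 2 \<or> P 3 \<or> P 4"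
  by (auto simp: less_5_iff)

lemma sum_less_5: "(\<Sum>k<5::nat. f k) = f 0 + f 1 + f 2 + f 3 + (f 4 :: nat)"
  by (simp add: eval_nat_numeral)

text \<open>Index 1 occurs in two forms since simp rewrites it to \<open>Suc 0\<close>, whereas
  \<open>simp only\<close> leaves it as \<open>1\<close>.\<close>

lemma data_simps:
  "Y 0 = 1" "Y (Suc 0) = 0" "Y 1 = 0" "Y 2 = 1" "Y 3 = \<gamma>" "Y 4 = \<beta> + 1"
  "Z 0 = 0" "Z (Suc 0) = 1" "Z 1 = 1" "Z 2 = 1" "Z 3 = 1" "Z 4 = 1"
  "p 0 = 1" "p (Suc 0) = 1" "p 1 = 1" "p 2 = 1" "p 3 = 1 / (\<alpha> * \<gamma>)" "p 4 = 1 / (\<alpha> * \<beta>)"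
  "r 0 = 1 / \<alpha>" "r (Suc 0) = 1 / (\<alpha> * \<gamma>)" "r 1 = 1 / (\<alpha> * \<gamma>)" "r 2 = 1 / (\<alpha> * \<beta>)"
  "r 3 = 1 / \<xi>" "r 4 = 1 / \<xi>"
  "c 0 = 0" "c (Suc 0) = 0" "c 1 = 0" "c 2 = 1" "c 3 = 1" "c 4 = 1"
  "d 0 = 0" "d (Suc 0) = 0" "d 1 = 0" "d 2 = 0" "d 3 = 1" "d 4 = 0"
  by (simp_all add: data_defs)

lemma km_set_eq: "km_set h \<alpha> \<beta> = (\<Union>k<5. part k)"
proof -
  have "(\<Union>k<5. part k) = part 0 \<union> part 1 \<union> part 2 \<union> part 3 \<union> part 4"
    by (auto simp: less_5_iff)
  then show ?thesis
    unfolding km_set_def Let_def by (simp add: part_def data_simps flip: \<gamma>_def \<xi>_def)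
qed

lemma \<alpha>\<beta>1: "\<alpha> * \<beta> + 1 \<noteq> 0" and \<beta>1: "\<beta> + 1 \<noteq> 0" and \<alpha>1: "\<alpha> + 1 \<noteq> 0"
  using \<alpha> \<beta> \<alpha>\<beta> by (simp_all add: add_eq_0_iff_eq)

lemma \<gamma>_mult: "\<gamma> * (\<alpha> * \<beta> + 1) = \<beta> + 1"
  using \<alpha>\<beta>1 by (simp add: \<gamma>_def km_gamma_def)

lemma \<xi>_eq: "\<xi> = \<alpha> * \<beta> * \<gamma>"
  by (simp add: \<xi>_def km_xi_def \<gamma>_def)

lemma \<gamma>_nz: "\<gamma> \<noteq> 0"
  using \<gamma>_mult \<beta>1 by auto

lemma \<gamma>_ne: "\<gamma> \<noteq> 1" "\<gamma> \<noteq> \<beta> + 1" "\<alpha> * \<gamma> \<noteq> 1"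
proof -
  show "\<gamma> \<noteq> 1" using \<gamma>_mult \<alpha> \<beta> by auto
  show "\<gamma> \<noteq> \<beta> + 1" using \<gamma>_mult \<beta>1 \<alpha> \<beta> by auto
  show "\<alpha> * \<gamma> \<noteq> 1"
  proof
    assume "\<alpha> * \<gamma> = 1"
    then have "\<alpha> * (\<beta> + 1) = \<alpha> * \<beta> + 1"
      using \<gamma>_mult by (metis mult.assoc mult_1)
    then show False using \<alpha> by (simp add: distrib_left)
  qed
qed

text \<open>The cross product compares the ratios 1:0, 0:1, 1:1, \<gamma>:1 and (\<beta> + 1):1
  without division, so that \<open>Z 0 = 0\<close> is no exception.\<close>

lemma nucleus_lines_distinct:
  assumes "j < 5" "k < 5" "Y j * Z k = Y k * Z j"
  shows "j = k"
  using assms \<beta>(1) \<beta>1 \<gamma>_nz \<gamma>_ne(1,2) \<gamma>_ne(1,2)[symmetric]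
  unfolding less_5_iff by (elim disjE; simp add: data_simps)

lemma YZ_nz: "k < 5 \<Longrightarrow> Y k \<noteq> 0 \<or> Z k \<noteq> 0"
  by (auto simp: less_5_iff data_simps)

text \<open>The hypotheses of \<open>card_Tr_class\<close> for each piece; the restrictions on
  \<alpha>, \<beta> and \<alpha>\<beta> keep the two multipliers apart.\<close>

lemma trace_data:
  assumes "k < 5"
  shows "p k \<noteq> 0" "r k \<noteq> 0" "p k \<noteq> r k" "c k \<in> {0, 1}" "d k \<in> {0, 1}"
proof -
  have "\<xi> \<noteq> 0" "\<alpha> * \<gamma> \<noteq> \<xi>" "\<alpha> * \<beta> \<noteq> \<xi>"
    using \<alpha> \<beta> \<gamma>_nz \<gamma>_ne(1) by (simp_all add: \<xi>_eq)
  then show "p k \<noteq> 0" "r k \<noteq> 0" "p k \<noteq> r k" "c k \<in> {0, 1}" "d k \<in> {0, 1}"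
    using assms \<alpha> \<beta> \<alpha>\<beta> \<gamma>_nz \<gamma>_ne(3) unfolding less_5_iff
    by (elim disjE; simp add: data_simps divide_eq_eq)+
qed

lemma pg_point_eq_iff:
  assumes "j < 5" "k < 5"
  shows "pg_point z (Y j) (Z j) = pg_point w (Y k) (Z k) \<longleftrightarrow> j = k \<and> z = w"
proof
  assume eq: "pg_point z (Y j) (Z j) = pg_point w (Y k) (Z k)"
  have "vector [z, Y j, Z j] \<noteq> (0 :: 'a ^ 3)" "vector [w, Y k, Z k] \<noteq> (0 :: 'a ^ 3)"
    using YZ_nz assms by (auto simp: vector_3_eq_0_iff)
  then obtain e where "vector [w, Y k, Z k] = e *s (vector [z, Y j, Z j] :: 'a ^ 3)"
    using eq unfolding pg_point_def by (auto simp: span_singleton_eq_iff)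
  then have e: "w = e * z" "Y k = e * Y j" "Z k = e * Z j"
    by (simp_all add: vector_3_eq_iff)
  then have "j = k" using assms by (intro nucleus_lines_distinct) simp_all
  moreover from this have "e = 1" using e YZ_nz[OF assms(1)] by auto
  ultimately show "j = k \<and> z = w" using e by simp
qed simp

lemma pg_point_in_points: "k < 5 \<Longrightarrow> pg_point z (Y k) (Z k) \<in> pg_points"
  unfolding pg_point_def using YZ_nz by (auto intro!: span_in_points simp: vector_3_eq_0_iff)

lemma pg_point_in_line_of:
  "k < 5 \<Longrightarrow> pg_point z (Y k) (Z k) \<in> line_of a \<longleftrightarrow> a $ 1 * z + a $ 2 * Y k + a $ 3 * Z k = 0"
  unfolding pg_point_def using YZ_nz[of k]
  by (subst span_in_line_of) (auto simp: vector_3_eq_0_iff lform_vector)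

section \<open>Size of the arc and its intersections with lines\<close>

lemma card_part:
  assumes "k < 5"
  shows "4 * card (part k) = CARD('a)"
proof -
  have "part k = (\<lambda>z. pg_point z (Y k) (Z k)) ` {z. Tr (p k * z) = c k \<and> Tr (r k * z) = d k}"
    by (auto simp: part_def)
  moreover have "inj_on (\<lambda>z. pg_point z (Y k) (Z k)) A" for A
    using assms by (simp add: inj_on_def pg_point_eq_iff)
  ultimately show ?thesis
    using card_Tr_class trace_data[OF assms] by (simp add: card_image)
qed

lemma card_part_eq: "k < 5 \<Longrightarrow> card (part k) = CARD('a) div 4"
  using card_part[of k] by simp

lemma part_disjoint:
  assumes "j < 5" "k < 5" "P \<in> part j" "P \<in> part k"
  shows "j = k"
  using assms pg_point_eq_iff by (auto simp: part_def)

lemma card_km_set: "card (km_set h \<alpha> \<beta>) = CARD('a) + CARD('a) div 4"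
proof -
  have "card (km_set h \<alpha> \<beta>) = (\<Sum>k<5. card (part k))"
    unfolding km_set_eq using part_disjoint by (intro card_UN_disjoint) auto
  also have "\<dots> = 5 * (CARD('a) div 4)"
    by (simp add: card_part_eq)
  finally have "card (km_set h \<alpha> \<beta>) = 5 * (CARD('a) div 4)" .
  moreover have "4 * (CARD('a) div 4) = CARD('a)"
    using card_part[of 0] card_part_eq[of 0] by (metis zero_less_numeral)
  ultimately show ?thesis by linarith
qed

text \<open>A line with \<open>a $ 1 = 0\<close> passes through the nucleus, so whether it contains
  a point of a piece does not depend on the first coordinate.\<close>

lemma km_set_line_through_nucleus:
  assumes a: "a \<noteq> 0" "a $ 1 = 0" and k: "k < 5" "a $ 2 * Y k + a $ 3 * Z k = 0"
  shows "km_set h \<alpha> \<beta> \<inter> line_of a = part k"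
proof -
  have unique: "j = k" if j: "j < 5" "a $ 2 * Y j + a $ 3 * Z j = 0" for j
  proof (rule nucleus_lines_distinct[OF j(1) k(1)])
    have 2: "a $ 2 * Y j = a $ 3 * Z j" "a $ 2 * Y k = a $ 3 * Z k"
      using j k by (simp_all add: add_eq_0_iff_eq)
    \<comment> \<open>Cross-multiplication yields the wanted equation times \<open>a $ 2\<close> and
      times \<open>a $ 3\<close>, one of which is nonzero.\<close>
    have "(a $ 2 * Y j) * Z k = (a $ 2 * Y k) * Z j"
      unfolding 2 by (simp only: mult_ac)
    moreover have "Y j * (a $ 3 * Z k) = Y k * (a $ 3 * Z j)"
      unfolding 2[symmetric] by (simp only: mult_ac)
    ultimately have "a $ 2 * (Y j * Z k) = a $ 2 * (Y k * Z j)" "a $ 3 * (Y j * Z k) = a $ 3 * (Y k * Z j)"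
      by (simp_all only: mult_ac)
    moreover have "a $ 2 \<noteq> 0 \<or> a $ 3 \<noteq> 0"
      using a by (auto simp: vec_eq_iff forall_3)
    ultimately show "Y j * Z k = Y k * Z j" by auto
  qed
  have on_line: "pg_point z (Y j) (Z j) \<in> line_of a \<longleftrightarrow> j = k" if "j < 5" for z j
    unfolding pg_point_in_line_of[OF that] a(2) using unique[OF that] k(2) by auto
  show ?thesis
  proof (intro subset_antisym subsetI)
    fix P assume "P \<in> km_set h \<alpha> \<beta> \<inter> line_of a"
    then obtain j where j: "j < 5" "P \<in> part j" "P \<in> line_of a"
      unfolding km_set_eq by blast
    then have "j = k" using on_line unfolding part_def by blast
    then show "P \<in> part k" using j by simp
  next
    fix P assume P: "P \<in> part k"
    then have "P \<in> line_of a" using on_line[OF k(1)] unfolding part_def by blast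
    then show "P \<in> km_set h \<alpha> \<beta> \<inter> line_of a" using P k(1) unfolding km_set_eq by blast
  qed
qed

lemma km_set_line_avoiding:
  assumes "a $ 1 = 0" "\<And>k. k < 5 \<Longrightarrow> a $ 2 * Y k + a $ 3 * Z k \<noteq> 0"
  shows "km_set h \<alpha> \<beta> \<inter> line_of a = {}"
proof (rule equals0I)
  fix P assume "P \<in> km_set h \<alpha> \<beta> \<inter> line_of a"
  then obtain k z where k: "k < 5" "pg_point z (Y k) (Z k) \<in> line_of a"
    unfolding km_set_eq part_def by blast
  then have "a $ 2 * Y k + a $ 3 * Z k = 0"
    unfolding pg_point_in_line_of[OF k(1)] assms(1) by simp
  then show False using assms(2)[OF k(1)] by blast
qed

text \<open>Rearranging \<gamma>(\<alpha>\<beta> + 1) = \<beta> + 1 and dividing by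
  \<alpha>\<beta>\<gamma> gives 1/\<xi> = 1 + 1/(\<alpha>\<gamma>) + 1/(\<alpha>\<beta>).\<close>

lemma Tr_n_div_\<xi>: "Tr (n / \<xi>) = Tr n + Tr (n / (\<alpha> * \<gamma>)) + Tr (n / (\<alpha> * \<beta>))"
proof -
  have "\<alpha> * \<beta> * \<gamma> + \<beta> + \<gamma> + 1 = 0"
    using \<gamma>_mult by (simp add: algebra_simps eq_add_iff)
  then have "n * (\<alpha> * \<beta> * \<gamma>) + n * \<beta> + n * \<gamma> + n * 1 = 0"
    unfolding distrib_left[symmetric] by simp
  then have "n / \<xi> = n + n / (\<alpha> * \<gamma>) + n / (\<alpha> * \<beta>)"
    using \<alpha> \<beta> \<gamma>_nz unfolding \<xi>_eq by (simp add: field_simps eq_add_iff)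
  then show ?thesis by (simp add: abs_trace_add)
qed

text \<open>A line off the nucleus meets the line of each piece once, at first coordinate m Y + n Z,
  so it suffices to count indices. The ten trace conditions are affine in the six bits
  \<open>a\<close>, \<open>b\<close>, \<open>e\<close>, \<open>u\<close>, \<open>v\<close>,
  \<open>g\<close>, and all 64 assignments are checked.\<close>

lemma card_affine_line:
  "card {k. k < 5 \<and> Tr (p k * (m * Y k + n * Z k)) = c k \<and> Tr (r k * (m * Y k + n * Z k)) = d k} \<in> {0, 2}"
  (is "card {k. k < 5 \<and> ?P k} \<in> _")
proof -
  define a b e where "a = Tr m" and "b = Tr (m / \<alpha>)" and "e = Tr (m / (\<alpha> * \<beta>))"
  define u v g where "u = Tr n" and "v = Tr (n / (\<alpha> * \<gamma>))" and "g = Tr (n / (\<alpha> * \<beta>))"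
  have P0: "?P 0 \<longleftrightarrow> a = 0 \<and> b = 0"
    by (simp add: data_simps a_def b_def)
  have P1: "?P 1 \<longleftrightarrow> u = 0 \<and> v = 0"
    by (simp add: data_simps u_def v_def)
  have P2: "?P 2 \<longleftrightarrow> a + u = 1 \<and> e + g = 0"
    by (simp add: data_simps a_def u_def e_def g_def abs_trace_add add_divide_distrib)
  have "p 3 * (m * Y 3 + n * Z 3) = m / \<alpha> + n / (\<alpha> * \<gamma>)"
    "r 3 * (m * Y 3 + n * Z 3) = m / (\<alpha> * \<beta>) + n / \<xi>"
    using \<alpha> \<beta> \<gamma>_nz by (simp_all add: data_simps \<xi>_eq field_simps)
  then have P3: "?P 3 \<longleftrightarrow> b + v = 1 \<and> e + (u + v + g) = 1"
    by (simp add: data_simps u_def e_def g_def b_def v_def abs_trace_add Tr_n_div_\<xi> flip: \<gamma>_def)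
  have "r 4 * (m * Y 4 + n * Z 4) = m * ((\<beta> + 1) / \<xi>) + n / \<xi>"
    unfolding data_simps by (simp add: divide_inverse algebra_simps)
  \<comment> \<open>As \<beta> + 1 = \<gamma>(\<alpha>\<beta> + 1), the quotient by \<xi> is
    (\<alpha>\<beta> + 1)/(\<alpha>\<beta>).\<close>
  moreover have "(\<beta> + 1) / \<xi> = 1 + 1 / (\<alpha> * \<beta>)"
    using \<alpha> \<beta> \<gamma>_nz unfolding \<xi>_eq \<gamma>_mult[symmetric] by (simp add: field_simps)
  ultimately have r4: "r 4 * (m * Y 4 + n * Z 4) = m + m / (\<alpha> * \<beta>) + n / \<xi>"
    by (simp only: distrib_left mult_1_right times_divide_eq_right)
  have p4: "p 4 * (m * Y 4 + n * Z 4) = m / \<alpha> + m / (\<alpha> * \<beta>) + n / (\<alpha> * \<beta>)"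
    using \<alpha> \<beta> by (simp add: data_simps field_simps)
  have P4: "?P 4 \<longleftrightarrow> b + e + g = 1 \<and> a + e + (u + v + g) = 0"
    unfolding p4 r4
    unfolding data_simps abs_trace_add Tr_n_div_\<xi> a_def b_def e_def u_def v_def g_def
    by (rule refl)
  have "{k. k < 5 \<and> ?P k} = {k \<in> {..<5}. ?P k}" by (simp only: lessThan_iff)
  then have "card {k. k < 5 \<and> ?P k} = (\<Sum>k<5. if ?P k then 1 else 0)"
    by (simp only: card_eq_sum sum.inter_filter finite_lessThan)
  also have "\<dots> = (if ?P 0 then 1 else 0) + (if ?P 1 then 1 else 0) + (if ?P 2 then 1 else 0)
    + (if ?P 3 then 1 else 0) + (if ?P 4 then 1 else 0)"
    by (rule sum_less_5)
  also have "\<dots> \<in> {0, 2}"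
    unfolding P0 P1 P2 P3 P4
    using Tr_cases[of m] Tr_cases[of "m / \<alpha>"] Tr_cases[of "m / (\<alpha> * \<beta>)"]
      Tr_cases[of n] Tr_cases[of "n / (\<alpha> * \<gamma>)"] Tr_cases[of "n / (\<alpha> * \<beta>)"]
    unfolding a_def[symmetric] b_def[symmetric] e_def[symmetric] u_def[symmetric]
      v_def[symmetric] g_def[symmetric]
    by (elim disjE) simp_all
  finally show ?thesis .
qed

lemma card_line_not_through_nucleus:
  assumes "a $ 1 \<noteq> 0"
  shows "card (km_set h \<alpha> \<beta> \<inter> line_of a) \<in> {0, 2}"
proof -
  define m n where "m = a $ 2 / a $ 1" and "n = a $ 3 / a $ 1"
  define K where "K = {k. k < 5 \<and> Tr (p k * (m * Y k + n * Z k)) = c k \<and>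
    Tr (r k * (m * Y k + n * Z k)) = d k}"
  have on_line: "pg_point z (Y k) (Z k) \<in> line_of a \<longleftrightarrow> z = m * Y k + n * Z k" if "k < 5" for z k
  proof -
    have "a $ 1 * z + a $ 2 * Y k + a $ 3 * Z k = a $ 1 * (z + (m * Y k + n * Z k))"
      using assms by (simp add: m_def n_def field_simps)
    then show ?thesis
      using that assms by (simp add: pg_point_in_line_of add_eq_0_iff_eq)
  qed
  have "km_set h \<alpha> \<beta> \<inter> line_of a = (\<lambda>k. pg_point (m * Y k + n * Z k) (Y k) (Z k)) ` K"
    unfolding km_set_eq K_def by (auto simp: part_def on_line)
  moreover have "inj_on (\<lambda>k. pg_point (m * Y k + n * Z k) (Y k) (Z k)) K"
    by (auto simp: inj_on_def K_def pg_point_eq_iff)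
  ultimately show ?thesis
    using card_affine_line[of m n] by (simp add: card_image K_def)
qed

lemma km_set_points: "km_set h \<alpha> \<beta> \<subseteq> pg_points"
  unfolding km_set_eq part_def using pg_point_in_points by auto

lemma KM_arc_km_set: "KM_arc (CARD('a) div 4) (km_set h \<alpha> \<beta>)"
  unfolding KM_arc_def
proof (intro conjI ballI)
  fix l :: "('a ^ 3) set set"
  assume "l \<in> pg_lines"
  then obtain a where a: "a \<noteq> 0" "l = line_of a" using pg_lines_eq by blast
  show "card (km_set h \<alpha> \<beta> \<inter> l) \<in> {0, 2, CARD('a) div 4}"
  proof (cases "a $ 1 = 0")
    case False
    then show ?thesis using card_line_not_through_nucleus a by auto
  next
    case True
    show ?thesis
    proof (cases "\<exists>k<5. a $ 2 * Y k + a $ 3 * Z k = 0")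
      case True
      then show ?thesis
        using km_set_line_through_nucleus[OF a(1) \<open>a $ 1 = 0\<close>] a card_part_eq by auto
    next
      case False
      then show ?thesis using km_set_line_avoiding[OF \<open>a $ 1 = 0\<close>] a by auto
    qed
  qed
qed (simp_all add: km_set_points card_km_set)

subsection \<open>The five conditions\<close>

text \<open>\<open>condition k\<close> is the equation under which the line carrying \<open>part k\<close> is a translation axis.\<close>

definition condition :: "nat \<Rightarrow> bool" where
  "condition k \<longleftrightarrow> [\<alpha> * \<beta>\<^sup>2 = 1, \<alpha> * \<beta> = \<beta> + 1, \<alpha> = \<beta>, \<alpha>\<^sup>2 * \<beta> = 1, \<alpha> * (\<beta> + 1) = 1] ! k"

lemma condition_simps:
  "condition 0 \<longleftrightarrow> \<alpha> * \<beta>\<^sup>2 = 1" "condition (Suc 0) \<longleftrightarrow> \<alpha> * \<beta> = \<beta> + 1"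
  "condition 1 \<longleftrightarrow> \<alpha> * \<beta> = \<beta> + 1" "condition 2 \<longleftrightarrow> \<alpha> = \<beta>"
  "condition 3 \<longleftrightarrow> \<alpha>\<^sup>2 * \<beta> = 1" "condition 4 \<longleftrightarrow> \<alpha> * (\<beta> + 1) = 1"
  by (simp_all add: condition_def)

text \<open>Denominators are cleared, and the square root is removed by squaring, which is
  injective.\<close>

lemma ex_condition_iff:
  "(\<exists>k<5. condition k) \<longleftrightarrow> \<alpha> \<in> {1 / \<beta>\<^sup>2, 1 + 1 / \<beta>, \<beta>, 1 / field_sqrt \<beta>, 1 / (\<beta> + 1)}"
proof -
  have s: "(field_sqrt \<beta>)\<^sup>2 = \<beta>" by (rule field_sqrt_square)
  then have s0: "field_sqrt \<beta> \<noteq> 0" using \<beta> by auto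
  have "\<alpha> = 1 / field_sqrt \<beta> \<longleftrightarrow> \<alpha>\<^sup>2 * \<beta> = 1"
  proof -
    have "\<alpha>\<^sup>2 * \<beta> = (\<alpha> * field_sqrt \<beta>)\<^sup>2" by (simp add: power_mult_distrib s)
    then have "\<alpha>\<^sup>2 * \<beta> = 1 \<longleftrightarrow> (\<alpha> * field_sqrt \<beta>)\<^sup>2 = 1\<^sup>2" by simp
    also have "\<dots> \<longleftrightarrow> \<alpha> * field_sqrt \<beta> = 1" by (rule power2_eq_iff_char_two)
    finally show ?thesis using s0 by (simp add: field_simps)
  qed
  moreover have "\<alpha> = 1 / \<beta>\<^sup>2 \<longleftrightarrow> \<alpha> * \<beta>\<^sup>2 = 1" "\<alpha> = 1 + 1 / \<beta> \<longleftrightarrow> \<alpha> * \<beta> = \<beta> + 1"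
    "\<alpha> = 1 / (\<beta> + 1) \<longleftrightarrow> \<alpha> * (\<beta> + 1) = 1"
    using \<beta> \<beta>1 by (simp_all only: eq_divide_eq) (simp_all add: field_simps)
  ultimately show ?thesis unfolding Ex_less_5 condition_simps by auto
qed

text \<open>For \<open>q = 8\<close> the arc is a hyperoval and \<open>2 = q div 4\<close>, so the lines through the nucleus are not
  distinguished by their intersection numbers.\<close>

lemma small_field_condition:
  assumes "CARD('a) div 4 \<le> 2"
  shows "\<exists>k<5. condition k"
proof -
  \<comment> \<open>Three distinct elements give q \<ge> 3; together with the upper bound, q is 4 or
    8.\<close>
  have "card {0, 1, \<alpha>} \<le> CARD('a)" by (rule card_mono) auto
  then have "3 \<le> CARD('a)" using \<alpha> by auto
  moreover have "CARD('a) < 12" using assms by simp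
  ultimately have "3 \<le> (2::nat) ^ h" "(2::nat) ^ h < 2 ^ 4" by (simp_all add: card_field)
  then have "h < 4" "h \<noteq> 0" "h \<noteq> 1" using power_less_imp_less_exp[of 2 h 4] by (auto intro!: Nat.gr0I)
  then consider "h = 2" | "h = 3" by linarith
  then show ?thesis
  proof cases
    case 1
    have quadratic: "x\<^sup>2 = x + 1" if "x \<noteq> 0" "x \<noteq> 1" for x :: 'a
    proof -
      have "x ^ 4 = x" using finite_field_power_card[of x] card_field 1 by simp
      moreover have "x * ((x + 1) * (x\<^sup>2 + x + 1)) = x ^ 4 + x"
        by (simp add: algebra_simps eval_nat_numeral)
      ultimately have "x * ((x + 1) * (x\<^sup>2 + x + 1)) = 0" by simp
      then show ?thesis using that by (simp add: add_eq_0_iff_eq add.assoc)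
    qed
    \<comment> \<open>For q = 4 both \<alpha> and \<beta> are roots of t^2 + t + 1, whose roots are
      \<beta> and \<beta> + 1; the second would give \<alpha>\<beta> = 1.\<close>
    have "(\<alpha> + \<beta>) * (\<alpha> + (\<beta> + 1)) = (\<alpha>\<^sup>2 + \<alpha>) + (\<beta>\<^sup>2 + \<beta>)"
      by (simp add: algebra_simps power2_eq_square)
    also have "\<dots> = 0" using quadratic \<alpha> \<beta> by (simp add: algebra_simps)
    finally have "\<alpha> = \<beta> \<or> \<alpha> = \<beta> + 1" by (simp add: add_eq_0_iff_eq)
    moreover have "\<alpha> \<noteq> \<beta> + 1"
    proof
      assume "\<alpha> = \<beta> + 1"
      then have "\<alpha> * \<beta> = \<beta>\<^sup>2 + \<beta>" by (simp add: algebra_simps power2_eq_square)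
      then show False using quadratic[OF \<beta>] \<alpha>\<beta> by (simp add: algebra_simps)
    qed
    ultimately show ?thesis unfolding Ex_less_5 condition_simps by blast
  next
    case 2
    then have q: "CARD('a) = 8" by (simp add: card_field)
    have "\<beta> ^ 8 = \<beta>" using finite_field_power_card[of \<beta>] q by simp
    then have \<beta>7: "\<beta> ^ 7 = 1" using \<beta>(1) by (simp add: eval_nat_numeral)
    \<comment> \<open>For q = 8, \<beta> generates the units. The exponents 0 and 6 are excluded by
      \<alpha> \<noteq> 1 and \<alpha>\<beta> \<noteq> 1; each of 1, ..., 5 satisfies a condition,
      which for 2 and 4 depends on the minimal polynomial of \<beta>.\<close>
    obtain k where k: "k < 7" "\<alpha> = \<beta> ^ k"
      using power_7_generates[OF q \<beta> \<alpha>(1)] .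
    have "k \<noteq> 0" using k \<alpha>(2) by (metis power_0)
    moreover have "k \<noteq> 6"
    proof
      assume "k = 6"
      then have "\<alpha> * \<beta> = \<beta> ^ 7" using k(2) by (simp add: eval_nat_numeral)
      then show False using \<alpha>\<beta> \<beta>7 by simp
    qed
    ultimately consider "k = 1" | "k = 2" | "k = 3" | "k = 4" | "k = 5" using k(1) by linarith
    then show ?thesis
    proof cases
      case 1
      then show ?thesis using k unfolding Ex_less_5 condition_simps by simp
    next
      case 2
      have "\<alpha> * \<beta> = \<beta> ^ 3" "\<alpha> * (\<beta> + 1) = \<beta> ^ 3 + \<beta>\<^sup>2"
        using k 2 by (simp_all add: algebra_simps eval_nat_numeral)
      then have "\<alpha> * \<beta> = \<beta> + 1 \<or> \<alpha> * (\<beta> + 1) = 1"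
        using cube_cases[OF \<beta>7 \<beta>(2)] by (auto simp: algebra_simps)
      then show ?thesis unfolding Ex_less_5 condition_simps by blast
    next
      case 3
      then have "\<alpha>\<^sup>2 * \<beta> = \<beta> ^ 7" using k by (simp add: algebra_simps eval_nat_numeral)
      then show ?thesis using \<beta>7 unfolding Ex_less_5 condition_simps by simp
    next
      case 4
      have "\<alpha> * \<beta> = \<beta> + 1" if "\<beta> ^ 3 = \<beta>\<^sup>2 + 1"
      proof -
        have "\<alpha> * \<beta> = \<beta>\<^sup>2 * \<beta> ^ 3" using k 4 by (simp add: algebra_simps eval_nat_numeral)
        also have "\<dots> = \<beta> * \<beta> ^ 3 + \<beta>\<^sup>2" by (subst that) (simp add: algebra_simps eval_nat_numeral)
        also have "\<dots> = \<beta> ^ 3 + \<beta> + \<beta>\<^sup>2" by (subst that) (simp add: algebra_simps eval_nat_numeral)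
        also have "\<dots> = \<beta> + 1" by (subst that) (simp add: algebra_simps)
        finally show ?thesis .
      qed
      moreover have "\<alpha> * (\<beta> + 1) = 1" if "\<beta> ^ 3 = \<beta> + 1"
        unfolding that[symmetric] k 4 using \<beta>7 by (simp flip: power_add)
      ultimately have "\<alpha> * \<beta> = \<beta> + 1 \<or> \<alpha> * (\<beta> + 1) = 1"
        using cube_cases[OF \<beta>7 \<beta>(2)] by blast
      then show ?thesis unfolding Ex_less_5 condition_simps by blast
    next
      case 5
      then have "\<alpha> * \<beta>\<^sup>2 = \<beta> ^ 7" using k by (simp add: algebra_simps eval_nat_numeral)
      then show ?thesis using \<beta>7 unfolding Ex_less_5 condition_simps by simp
    qed
  qed
qed

subsection \<open>Translation sets with axis through the nucleus\<close>

text \<open>For \<open>a $ 1 = 0\<close>, the value of the form at every vector (z,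
  \<open>Y k\<close>, \<open>Z k\<close>). It vanishes when the line of \<open>a\<close> carries
  piece k; otherwise it is the divisor that normalises the points of that piece.\<close>

definition \<phi> :: "'a ^ 3 \<Rightarrow> nat \<Rightarrow> 'a" where "\<phi> a k = a $ 2 * Y k + a $ 3 * Z k"

lemma span_in_km_set_iff:
  assumes "v \<noteq> 0"
  shows "vec.span {v} \<in> km_set h \<alpha> \<beta> \<longleftrightarrow> (\<exists>k<5. \<exists>e. e \<noteq> 0 \<and> v $ 2 = e * Y k \<and> v $ 3 = e * Z k \<and>
    Tr (p k * (v $ 1 / e)) = c k \<and> Tr (r k * (v $ 1 / e)) = d k)"
proof -
  have "vec.span {v} = pg_point z (Y k) (Z k) \<longleftrightarrow>
      (\<exists>e. e \<noteq> 0 \<and> z = v $ 1 / e \<and> v $ 2 = e * Y k \<and> v $ 3 = e * Z k)" if "k < 5" for k z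
  proof -
    have nz: "vector [z, Y k, Z k] \<noteq> (0 :: 'a ^ 3)"
      using YZ_nz[OF that] by (auto simp: vector_3_eq_0_iff)
    have "vec.span {v} = pg_point z (Y k) (Z k) \<longleftrightarrow> pg_point z (Y k) (Z k) = vec.span {v}"
      by (rule eq_commute)
    also have "\<dots> \<longleftrightarrow> (\<exists>e. e \<noteq> 0 \<and> v = e *s vector [z, Y k, Z k])"
      unfolding pg_point_def by (rule span_singleton_eq_iff[OF nz assms])
    also have "\<dots> \<longleftrightarrow> (\<exists>e. e \<noteq> 0 \<and> v $ 1 = e * z \<and> v $ 2 = e * Y k \<and> v $ 3 = e * Z k)"
      by (simp add: vec_eq_iff forall_3)
    moreover have "v $ 1 = e * z \<longleftrightarrow> z = v $ 1 / e" if "e \<noteq> 0" for e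
      using that by (auto simp: eq_divide_eq mult.commute)
    ultimately show ?thesis by (simp cong: conj_cong)
  qed
  note pt = this
  have "vec.span {v} \<in> part k \<longleftrightarrow> (\<exists>e. e \<noteq> 0 \<and> v $ 2 = e * Y k \<and> v $ 3 = e * Z k \<and>
      Tr (p k * (v $ 1 / e)) = c k \<and> Tr (r k * (v $ 1 / e)) = d k)" (is "_ \<longleftrightarrow> ?R") if "k < 5" for k
  proof -
    have "vec.span {v} \<in> part k \<longleftrightarrow> (\<exists>z. (\<exists>e. e \<noteq> 0 \<and> z = v $ 1 / e \<and> v $ 2 = e * Y k \<and> v $ 3 = e * Z k)
        \<and> Tr (p k * z) = c k \<and> Tr (r k * z) = d k)" (is "_ \<longleftrightarrow> ?L")
      by (simp only: part_def mem_Collect_eq pt[OF that])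
    also have "?L \<longleftrightarrow> ?R"
    proof
      assume ?L
      then obtain z e where e: "e \<noteq> 0" "z = v $ 1 / e" "v $ 2 = e * Y k" "v $ 3 = e * Z k"
        "Tr (p k * z) = c k" "Tr (r k * z) = d k" by (elim exE conjE)
      show ?R by (rule exI[of _ e]) (use e in simp)
    next
      assume ?R
      then obtain e where e: "e \<noteq> 0" "v $ 2 = e * Y k" "v $ 3 = e * Z k"
        "Tr (p k * (v $ 1 / e)) = c k" "Tr (r k * (v $ 1 / e)) = d k" by (elim exE conjE)
      show ?L by (rule exI[of _ "v $ 1 / e"], intro conjI exI[of _ e]) (use e in simp_all)
    qed
    finally show ?thesis .
  qed
  then show ?thesis by (simp add: km_set_eq Bex_def cong: conj_cong)
qed

text \<open>Normalisation leaves 1 / \<open>\<phi> a k\<close> as the only possible scalar, so the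
  trace multipliers of piece k are rescaled by \<open>\<phi> a k\<close>.\<close>

lemma normalized_in_km_set_iff:
  assumes v: "lform a v = 1" and a: "a $ 1 = 0"
  shows "vec.span {v} \<in> km_set h \<alpha> \<beta> \<longleftrightarrow> (\<exists>k<5. \<phi> a k \<noteq> 0 \<and> v $ 2 = Y k / \<phi> a k \<and> v $ 3 = Z k / \<phi> a k \<and>
    Tr (p k * \<phi> a k * v $ 1) = c k \<and> Tr (r k * \<phi> a k * v $ 1) = d k)"
proof -
  have v0: "v \<noteq> 0" using v by auto
  have "(\<exists>e. e \<noteq> 0 \<and> v $ 2 = e * Y k \<and> v $ 3 = e * Z k \<and>
      Tr (p k * (v $ 1 / e)) = c k \<and> Tr (r k * (v $ 1 / e)) = d k) \<longleftrightarrow>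
    (\<phi> a k \<noteq> 0 \<and> v $ 2 = Y k / \<phi> a k \<and> v $ 3 = Z k / \<phi> a k \<and>
      Tr (p k * \<phi> a k * v $ 1) = c k \<and> Tr (r k * \<phi> a k * v $ 1) = d k)" (is "?L \<longleftrightarrow> ?R") for k
  proof
    assume ?L
    then obtain e where e: "e \<noteq> 0" "v $ 2 = e * Y k" "v $ 3 = e * Z k"
      "Tr (p k * (v $ 1 / e)) = c k" "Tr (r k * (v $ 1 / e)) = d k" by blast
    have "e * \<phi> a k = 1"
      using v a e(2,3) by (simp add: lform_def \<phi>_def algebra_simps)
    moreover from this have "\<phi> a k \<noteq> 0" by auto
    ultimately have "\<phi> a k \<noteq> 0" "e = 1 / \<phi> a k" by (simp_all add: eq_divide_eq)
    then show ?R using e by (simp add: mult_ac)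
  next
    assume ?R
    then show ?L by (intro exI[of _ "1 / \<phi> a k"]) (simp add: mult_ac)
  qed
  then show ?thesis unfolding span_in_km_set_iff[OF v0] by blast
qed

lemma lform_eq_\<phi>:
  assumes "b $ 1 = 0" "v $ 2 = Y k / e" "v $ 3 = Z k / e"
  shows "lform b v = \<phi> b k / e"
  using assms by (simp add: lform_def \<phi>_def add_divide_distrib)

text \<open>In the coordinates (\<open>lform b v\<close>, \<open>v $ 1\<close>) piece k lies at
  height \<open>\<phi> b k / \<phi> a k\<close>, and its first coordinates form the coset with label
  (\<open>C k\<close>, \<open>D k\<close>) of the group Tr(Ax) = Tr(Bx) = 0. If heights and labels
  sum to 0 over the four pieces, a ternary sum of points lands in a piece again.\<close>

lemma translation_set_km_setI:
  assumes j: "j < 5" and a: "a \<noteq> 0" "a $ 1 = 0" "b $ 1 = 0" and aj: "\<phi> a j = 0"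
    and ab: "a $ 2 * b $ 3 + a $ 3 * b $ 2 \<noteq> 0"
    and Tr_iff: "\<And>k x. k < 5 \<Longrightarrow> k \<noteq> j \<Longrightarrow> \<phi> a k \<noteq> 0 \<and>
      (Tr (p k * \<phi> a k * x) = c k \<and> Tr (r k * \<phi> a k * x) = d k \<longleftrightarrow>
       Tr (A * x) = C k \<and> Tr (B * x) = D k)"
    and zero: "(\<Sum>k\<in>{..<5} - {j}. \<phi> b k / \<phi> a k) = 0" "sum C ({..<5} - {j}) = 0"
      "sum D ({..<5} - {j}) = 0"
  shows "translation_set (line_of a) (km_set h \<alpha> \<beta>)"
proof (rule translation_setI[OF a(1) km_set_points])
  let ?K = "{..<5} - {j}"
  let ?S = "km_set h \<alpha> \<beta>"
  have K: "card ?K = 4" using j by simp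
  \<comment> \<open>Cramer's rule: the independent forms \<open>a\<close> and \<open>b\<close>
    determine the last two coordinates.\<close>
  have coords: "v $ 2 = v' $ 2 \<and> v $ 3 = v' $ 3"
    if "lform a v = lform a v'" "lform b v = lform b v'" for v v'
  proof -
    have eq: "a $ 2 * (v $ 2 + v' $ 2) = a $ 3 * (v $ 3 + v' $ 3)"
      "b $ 2 * (v $ 2 + v' $ 2) = b $ 3 * (v $ 3 + v' $ 3)"
      using that a(2,3) unfolding lform_def
      by (simp_all add: algebra_simps eq_add_iff)
    have "(a $ 2 * b $ 3 + a $ 3 * b $ 2) * (v $ 2 + v' $ 2) =
        b $ 3 * (a $ 2 * (v $ 2 + v' $ 2)) + a $ 3 * (b $ 2 * (v $ 2 + v' $ 2))"
      by (simp add: algebra_simps)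
    also have "\<dots> = 0" unfolding eq by (simp add: mult.left_commute)
    finally have 2: "v $ 2 = v' $ 2" using ab by (simp add: add_eq_0_iff_eq)
    have "(a $ 2 * b $ 3 + a $ 3 * b $ 2) * (v $ 3 + v' $ 3) =
        a $ 2 * (b $ 3 * (v $ 3 + v' $ 3)) + b $ 2 * (a $ 3 * (v $ 3 + v' $ 3))"
      by (simp add: algebra_simps)
    also have "\<dots> = 0" unfolding eq[symmetric] by (simp add: mult.left_commute)
    finally have "v $ 3 = v' $ 3" using ab by (simp add: add_eq_0_iff_eq)
    with 2 show ?thesis by simp
  qed
  have mem: "vec.span {v} \<in> ?S \<longleftrightarrow>
    (\<exists>k\<in>?K. lform b v = \<phi> b k / \<phi> a k \<and> Tr (A * v $ 1) = C k \<and> Tr (B * v $ 1) = D k)"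
    if v: "lform a v = 1" for v
  proof -
    have "v $ 2 = Y k / \<phi> a k \<and> v $ 3 = Z k / \<phi> a k \<longleftrightarrow> lform b v = \<phi> b k / \<phi> a k"
      if k: "k \<in> ?K" for k
    proof
      assume "v $ 2 = Y k / \<phi> a k \<and> v $ 3 = Z k / \<phi> a k"
      then show "lform b v = \<phi> b k / \<phi> a k" using lform_eq_\<phi>[OF a(3)] by blast
    next
      assume bv: "lform b v = \<phi> b k / \<phi> a k"
      let ?v = "vector [0, Y k / \<phi> a k, Z k / \<phi> a k]"
      have "lform a ?v = 1" "lform b ?v = \<phi> b k / \<phi> a k"
        using k Tr_iff[of k] a by (simp_all add: lform_def \<phi>_def flip: add_divide_distrib)
      then show "v $ 2 = Y k / \<phi> a k \<and> v $ 3 = Z k / \<phi> a k"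
        using coords[of v ?v] v bv by simp
    qed
    moreover have "k \<noteq> j" if "\<phi> a k \<noteq> 0" for k using that aj by blast
    ultimately show ?thesis
      unfolding normalized_in_km_set_iff[OF v a(2)] using Tr_iff by (metis Diff_iff lessThan_iff singletonD singletonI)
  qed
  fix u v x
  assume uvx: "lform a u = 1" "vec.span {u} \<in> ?S" "lform a v = 1" "vec.span {v} \<in> ?S"
    "lform a x = 1" "vec.span {x} \<in> ?S"
  obtain i where i: "i \<in> ?K" "lform b u = \<phi> b i / \<phi> a i" "Tr (A * u $ 1) = C i" "Tr (B * u $ 1) = D i"
    using uvx mem by blast
  obtain k where k: "k \<in> ?K" "lform b v = \<phi> b k / \<phi> a k" "Tr (A * v $ 1) = C k" "Tr (B * v $ 1) = D k"
    using uvx mem by blast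
  obtain l where l: "l \<in> ?K" "lform b x = \<phi> b l / \<phi> a l" "Tr (A * x $ 1) = C l" "Tr (B * x $ 1) = D l"
    using uvx mem by blast
  obtain m where m: "m \<in> ?K" "\<And>t :: nat \<Rightarrow> 'a. sum t ?K = 0 \<Longrightarrow> t l + (t k + t i) = t m"
    using four_element_ternary_sum[OF K i(1) k(1) l(1)] by metis
  show "vec.span {x + (v - u)} \<in> ?S"
  proof (subst mem)
    show "lform a (x + (v - u)) = 1" using uvx by (simp add: lform_linear)
    have "lform b (x + (v - u)) = \<phi> b m / \<phi> a m"
      using m(2)[OF zero(1)] i(2) k(2) l(2) by (simp add: lform_linear minus_eq_add)
    moreover have "Tr (A * (x + (v - u)) $ 1) = C m"
      using m(2)[OF zero(2)] i(3) k(3) l(3) by (simp add: distrib_left abs_trace_add minus_eq_add)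
    moreover have "Tr (B * (x + (v - u)) $ 1) = D m"
      using m(2)[OF zero(3)] i(4) k(4) l(4) by (simp add: distrib_left abs_trace_add minus_eq_add)
    ultimately show "\<exists>k\<in>?K. lform b (x + (v - u)) = \<phi> b k / \<phi> a k \<and>
      Tr (A * (x + (v - u)) $ 1) = C k \<and> Tr (B * (x + (v - u)) $ 1) = D k"
      using m(1) by blast
  qed
qed

text \<open>The line through the nucleus that carries piece j; in characteristic 2 the vector
  orthogonal to (\<open>Y j\<close>, \<open>Z j\<close>) needs no sign.\<close>

definition nucleus_axis :: "nat \<Rightarrow> 'a ^ 3" where "nucleus_axis j = vector [0, Z j, Y j]"

lemma nucleus_axis_simps [simp]:
  "nucleus_axis j $ 1 = 0" "nucleus_axis j $ 2 = Z j" "nucleus_axis j $ 3 = Y j"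
  by (simp_all add: nucleus_axis_def)

lemma nucleus_axis_nz: "j < 5 \<Longrightarrow> nucleus_axis j \<noteq> 0"
  using YZ_nz[of j] by (auto simp: nucleus_axis_def vector_3_eq_0_iff)

lemma \<phi>_nucleus_axis: "\<phi> (nucleus_axis j) k = Z j * Y k + Y j * Z k"
  by (simp add: \<phi>_def)

lemma \<phi>_nucleus_axis_eq_0_iff: "j < 5 \<Longrightarrow> k < 5 \<Longrightarrow> \<phi> (nucleus_axis j) k = 0 \<longleftrightarrow> k = j"
  using nucleus_lines_distinct[of j k]
  by (auto simp: \<phi>_nucleus_axis add_eq_0_iff_eq mult.commute)

lemma \<gamma>_eqI: "g * (\<alpha> * \<beta> + 1) = \<beta> + 1 \<Longrightarrow> \<gamma> = g"
  using \<gamma>_mult \<alpha>\<beta>1 by (metis mult_right_cancel)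

text \<open>The criterion with \<phi> written out and A = 1. For each axis it remains to express
  eight trace conditions by Tr x and Tr(Bx) and to check three sums of four terms.\<close>

lemma translation_set_nucleus_axisI:
  fixes b :: "'a ^ 3"
  assumes j: "j < 5" and b: "b $ 1 = 0" "Z j * b $ 3 + Y j * b $ 2 \<noteq> 0"
    and Tr_iff: "\<And>k x. k < 5 \<Longrightarrow> k \<noteq> j \<Longrightarrow>
      Tr (p k * (Z j * Y k + Y j * Z k) * x) = c k \<and> Tr (r k * (Z j * Y k + Y j * Z k) * x) = d k \<longleftrightarrow>
       Tr x = C k \<and> Tr (B * x) = D k"
    and zero: "(\<Sum>k\<in>{..<5} - {j}. (b $ 2 * Y k + b $ 3 * Z k) / (Z j * Y k + Y j * Z k)) = 0"
      "sum C ({..<5} - {j}) = 0" "sum D ({..<5} - {j}) = 0"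
  shows "translation_set (line_of (nucleus_axis j)) (km_set h \<alpha> \<beta>)"
proof (rule translation_set_km_setI[OF j nucleus_axis_nz[OF j] nucleus_axis_simps(1) b(1), where A = 1])
  show "\<phi> (nucleus_axis j) k \<noteq> 0 \<and>
      (Tr (p k * \<phi> (nucleus_axis j) k * x) = c k \<and> Tr (r k * \<phi> (nucleus_axis j) k * x) = d k \<longleftrightarrow>
       Tr (1 * x) = C k \<and> Tr (B * x) = D k)" if "k < 5" "k \<noteq> j" for k x
    using Tr_iff[OF that, of x] \<phi>_nucleus_axis_eq_0_iff[OF j that(1)] that(2)
    by (simp add: \<phi>_nucleus_axis)
  show "\<phi> (nucleus_axis j) j = 0"
    using \<phi>_nucleus_axis_eq_0_iff[OF j j] by simp
  show "(\<Sum>k\<in>{..<5} - {j}. \<phi> b k / \<phi> (nucleus_axis j) k) = 0"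
    using zero(1) by (simp add: \<phi>_nucleus_axis) (simp add: \<phi>_def)
qed (use zero b(2) in simp_all)

section \<open>The five axes, one by one\<close>

lemma translation_set_axis_0:
  assumes "\<alpha> * \<beta>\<^sup>2 = 1"
  shows "translation_set (line_of (nucleus_axis 0)) (km_set h \<alpha> \<beta>)"
proof -
  have \<gamma>': "\<gamma> = \<beta>"
    by (rule \<gamma>_eqI) (use assms in \<open>simp add: algebra_simps power2_eq_square\<close>)
  have \<xi>': "\<xi> = 1" using assms by (simp add: \<xi>_eq \<gamma>' power2_eq_square mult.assoc)
  have *: "1 / (\<alpha> * \<gamma>) = \<beta>" "1 / (\<alpha> * \<beta>) = \<beta>"
    unfolding \<gamma>' using \<alpha>(1) \<beta>(1) assms by (simp_all add: divide_eq_eq power2_eq_square mult_ac)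
  show ?thesis
  \<comment> \<open>Here \<open>Z 0 = 0\<close>, so the normalising divisor is 1 for all other
    pieces and their heights are 0, 1, \<beta>, \<beta> + 1; the labels run through F_2^2.\<close>
  proof (rule translation_set_nucleus_axisI[where b = "vector [0, 1, 0]" and B = \<beta>
        and C = "\<lambda>k. [0, 0, 1, 1, 0] ! k" and D = "\<lambda>k. [0, 0, 0, 1, 1] ! k"])
    fix k :: nat and x :: 'a
    assume "k < 5" "k \<noteq> 0"
    then show "Tr (p k * (Z 0 * Y k + Y 0 * Z k) * x) = c k \<and> Tr (r k * (Z 0 * Y k + Y 0 * Z k) * x) = d k \<longleftrightarrow>
       Tr x = [0, 0, 1, 1, 0] ! k \<and> Tr (\<beta> * x) = [0, 0, 0, 1, 1] ! k"
      unfolding less_5_iff by (elim disjE) (simp_all add: data_simps * \<xi>' conj_commute)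
  qed (simp_all only: sum_less_5_minus data_simps, simp_all add: \<gamma>')
qed

text \<open>The condition gives \<gamma> = \<alpha> and 1/(\<alpha>\<beta>) = 1 + 1/\<alpha>, so all
  traces become combinations of Tr x and Tr(x/\<alpha>); the four labels are distinct.\<close>

lemma translation_set_axis_1:
  assumes "\<alpha> * \<beta> = \<beta> + 1"
  shows "translation_set (line_of (nucleus_axis 1)) (km_set h \<alpha> \<beta>)"
proof -
  have \<beta>': "\<beta> + 1 = \<alpha> * \<beta>" using assms by simp
  have \<gamma>': "\<gamma> = \<alpha>"
    by (rule \<gamma>_eqI) (use assms in \<open>simp add: algebra_simps\<close>)
  have "\<beta> * (\<alpha> + 1) = 1" using assms by (simp add: algebra_simps)
  then have B: "1 / \<beta> = \<alpha> + 1" using \<beta> by (simp add: divide_eq_eq mult.commute)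
  then have B': "1 / (\<alpha> * \<beta>) = 1 + 1 / \<alpha>"
    using \<alpha> \<beta> by (simp add: field_simps)
  have *: "1 / (\<alpha> * \<beta>) * (\<beta> + 1) = 1" "1 / \<xi> * (\<beta> + 1) = 1 / \<alpha>" "1 / \<xi> * \<gamma> = 1 + 1 / \<alpha>"
    "1 / (\<alpha> * \<gamma>) * \<gamma> = 1 / \<alpha>"
    unfolding \<xi>_eq \<gamma>' \<beta>' B'[symmetric] using \<alpha> \<beta> by simp_all
  show ?thesis
  proof (rule translation_set_nucleus_axisI[where b = "vector [0, 0, 1]" and B = "1 / \<alpha>"
        and C = "\<lambda>k. [0, 0, 1, 0, 1] ! k" and D = "\<lambda>k. [0, 0, 1, 1, 0] ! k"])
    fix k :: nat and x :: 'a
    assume k: "k < 5" "k \<noteq> 1"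
    then show "Tr (p k * (Z 1 * Y k + Y 1 * Z k) * x) = c k \<and> Tr (r k * (Z 1 * Y k + Y 1 * Z k) * x) = d k \<longleftrightarrow>
       Tr x = [0, 0, 1, 0, 1] ! k \<and> Tr (1 / \<alpha> * x) = [0, 0, 1, 1, 0] ! k"
      unfolding less_5_iff using Tr_cases[of x] Tr_cases[of "1 / \<alpha> * x"]
      by (elim disjE) (simp_all only: data_simps mult_1 mult_1_right mult_zero_right mult_zero_left
          add_0_right add_0_left, simp_all only: *, simp_all only: B' distrib_right abs_trace_add mult_1, simp_all)
  next
    have "1 / \<gamma> + 1 / (\<beta> + 1) = 1"
      unfolding \<gamma>' \<beta>' B' by (simp add: algebra_simps)
    then show "(\<Sum>k\<in>{..<5} - {1}. ((vector [0, 0, 1] :: 'a ^ 3) $ 2 * Y k + (vector [0, 0, 1] :: 'a ^ 3) $ 3 * Z k) /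
        (Z 1 * Y k + Y 1 * Z k)) = 0"
      by (simp only: sum_less_5_minus data_simps) (simp add: add.assoc)
  qed (simp_all only: sum_less_5_minus data_simps, simp_all)
qed

text \<open>With \<alpha> = \<beta> one has \<alpha>\<beta> + 1 = (\<beta> + 1)^2, hence \<gamma> =
  1/(\<beta> + 1). After normalisation pieces 0 and 1 have label (0, 0), pieces 3 and 4 label (1,
  1).\<close>

lemma translation_set_axis_2:
  assumes "\<alpha> = \<beta>"
  shows "translation_set (line_of (nucleus_axis 2)) (km_set h \<alpha> \<beta>)"
proof -
  define \<tau> where "\<tau> = \<beta> + 1"
  have \<tau>: "\<tau> \<noteq> 0" "\<beta> * \<beta> + 1 = \<tau> * \<tau>" "\<tau> / \<beta> = 1 + 1 / \<beta>" "\<tau> + 1 = \<beta>"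
    using \<beta> \<beta>1 by (simp_all add: \<tau>_def algebra_simps add_divide_distrib)
  have \<gamma>': "\<gamma> = 1 / \<tau>"
    by (rule \<gamma>_eqI) (use assms \<tau> in \<open>simp flip: \<tau>_def\<close>)
  have "1 / \<tau> + 1 = (\<tau> + 1) / \<tau>" using \<tau>(1) by (simp only: add_divide_distrib) simp
  then have \<gamma>1: "1 + \<gamma> = \<beta> / \<tau>" unfolding \<gamma>' \<tau>(4) by (simp add: add.commute)
  have \<xi>': "\<xi> = \<beta> * \<beta> / \<tau>" unfolding \<xi>_eq \<gamma>' using assms by simp
  have \<beta>2: "\<beta> + 1 + 1 = \<beta>" by (simp add: add.assoc)
  have "1 / (\<alpha> * \<gamma>) = \<tau> / \<beta>" "1 / \<alpha> = 1 / \<beta>"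
    unfolding \<gamma>' using assms by simp_all
  note single = this[unfolded \<tau>(3)]
  have "1 / \<xi> * \<beta> = \<tau> / \<beta>" "1 / (\<alpha> * \<gamma>) * (\<gamma> + 1) = 1" "1 / \<xi> * (\<gamma> + 1) = 1 / \<beta>"
    "1 / (\<alpha> * \<beta>) * \<beta> = 1 / \<beta>"
    unfolding \<xi>' add.commute[of \<gamma> 1] \<gamma>1 unfolding \<gamma>' using assms \<beta> \<tau>(1) by simp_all
  note * = this[unfolded \<tau>(3)]
  have ** : "1 / (1 + \<gamma>) = 1 + 1 / \<beta>" unfolding \<gamma>1 using \<tau>(3) by simp
  show ?thesis
  proof (rule translation_set_nucleus_axisI[where b = "vector [0, 0, 1]" and B = "1 / \<beta>"
        and C = "\<lambda>k. [0, 0, 0, 1, 1] ! k" and D = "\<lambda>k. [0, 0, 0, 1, 1] ! k"])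
    fix k :: nat and x :: 'a
    assume k: "k < 5" "k \<noteq> 2"
    then show "Tr (p k * (Z 2 * Y k + Y 2 * Z k) * x) = c k \<and> Tr (r k * (Z 2 * Y k + Y 2 * Z k) * x) = d k \<longleftrightarrow>
       Tr x = [0, 0, 0, 1, 1] ! k \<and> Tr (1 / \<beta> * x) = [0, 0, 0, 1, 1] ! k"
      unfolding less_5_iff using Tr_cases[of x] Tr_cases[of "1 / \<beta> * x"]
      by (elim disjE) (simp_all only: data_simps mult_1 mult_1_right mult_zero_right mult_zero_left
          add_0_right add_0_left, simp_all only: \<beta>2 *, simp_all only: single distrib_right abs_trace_add mult_1, simp_all)
  next
    show "(\<Sum>k\<in>{..<5} - {2}. ((vector [0, 0, 1] :: 'a ^ 3) $ 2 * Y k + (vector [0, 0, 1] :: 'a ^ 3) $ 3 * Z k) /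
        (Z 2 * Y k + Y 2 * Z k)) = 0"
      by (simp only: sum_less_5_minus data_simps) (simp add: ** add_divide_distrib add_ac)
  qed (simp_all only: sum_less_5_minus data_simps, simp_all)
qed

text \<open>Now \<beta> = 1/\<alpha>^2, so everything is a function of \<alpha>, with \<gamma> =
  (\<alpha> + 1)/\<alpha>. After normalisation all four pieces satisfy Tr x = 0, and Tr(x/\<alpha>)
  separates 0, 1 from 2, 4.\<close>

lemma translation_set_axis_3:
  assumes "\<alpha>\<^sup>2 * \<beta> = 1"
  shows "translation_set (line_of (nucleus_axis 3)) (km_set h \<alpha> \<beta>)"
proof -
  define \<tau> where "\<tau> = \<alpha> + 1"
  have \<tau>: "\<tau> \<noteq> 0" "\<alpha> * \<alpha> + 1 = \<tau> * \<tau>" "\<tau> / \<alpha> = 1 + 1 / \<alpha>" "\<tau> + \<alpha> = 1"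
    using \<alpha> \<alpha>1 by (simp_all add: \<tau>_def algebra_simps add_divide_distrib)
  have \<alpha>\<beta>': "\<alpha> * \<beta> = 1 / \<alpha>" and \<beta>': "\<beta> = 1 / (\<alpha> * \<alpha>)"
    using assms \<alpha> by (simp_all add: eq_divide_eq power2_eq_square mult_ac)
  have "\<tau> / \<alpha> * (1 / \<alpha> + 1) = (\<tau> * \<tau>) / (\<alpha> * \<alpha>)"
    using \<tau>(3) \<alpha>(1) by (metis add.commute times_divide_times_eq)
  also have \<beta>\<tau>: "(\<tau> * \<tau>) / (\<alpha> * \<alpha>) = \<beta> + 1"
    using \<alpha>(1) unfolding \<tau>(2)[symmetric] add_divide_distrib by (simp flip: \<beta>' add: add.commute)
  finally have \<gamma>': "\<gamma> = \<tau> / \<alpha>" by (intro \<gamma>_eqI) (simp only: \<alpha>\<beta>')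
  have \<xi>': "\<xi> = \<tau> / (\<alpha> * \<alpha>)" unfolding \<xi>_eq \<gamma>' \<alpha>\<beta>' by simp
  have \<gamma>1: "1 + \<gamma> = 1 / \<alpha>" unfolding \<gamma>' \<tau>(3) by simp
  have "\<tau> * \<tau> + \<tau> * \<alpha> = \<tau>" unfolding distrib_left[symmetric] \<tau>(4) by simp
  moreover have "\<beta> + 1 + \<gamma> = (\<tau> * \<tau> + \<tau> * \<alpha>) / (\<alpha> * \<alpha>)"
    unfolding \<beta>\<tau>[symmetric] \<gamma>' add_divide_distrib using \<alpha>(1) by simp
  ultimately have \<beta>\<gamma>: "\<beta> + 1 + \<gamma> = \<tau> / (\<alpha> * \<alpha>)" by simp
  note single = \<gamma>'[unfolded \<tau>(3)]
  have "1 / (\<alpha> * \<gamma>) * \<gamma> = 1 / \<alpha>" "1 / (\<alpha> * \<beta>) * (1 + \<gamma>) = 1"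
    "1 / (\<alpha> * \<beta>) * (\<beta> + 1 + \<gamma>) = \<tau> / \<alpha>" "1 / \<xi> * (\<beta> + 1 + \<gamma>) = 1"
    unfolding \<beta>\<gamma> \<gamma>1 \<xi>' \<alpha>\<beta>' unfolding \<gamma>' using \<alpha>(1) \<tau>(1) by simp_all
  note * = this[unfolded \<tau>(3)]
  have ** : "1 / \<gamma> = \<alpha> / \<tau>" "1 / (1 + \<gamma>) = \<alpha>" "1 / (\<beta> + 1 + \<gamma>) = \<alpha> * \<alpha> / \<tau>"
    unfolding \<beta>\<gamma> \<gamma>1 unfolding \<gamma>' by simp_all
  have "\<alpha> / \<tau> + (\<alpha> + \<alpha> * \<alpha> / \<tau>) = 0"
    using \<tau>(1) by (simp add: field_simps) (simp add: \<tau>_def algebra_simps)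
  then have sum: "1 / \<gamma> + (1 / (1 + \<gamma>) + 1 / (\<beta> + 1 + \<gamma>)) = 0" unfolding ** .
  show ?thesis
  proof (rule translation_set_nucleus_axisI[where b = "vector [0, 0, 1]" and B = "1 / \<alpha>"
        and C = "\<lambda>k. [0, 0, 0, 0, 0] ! k" and D = "\<lambda>k. [0, 0, 1, 0, 1] ! k"])
    fix k :: nat and x :: 'a
    assume k: "k < 5" "k \<noteq> 3"
    then show "Tr (p k * (Z 3 * Y k + Y 3 * Z k) * x) = c k \<and> Tr (r k * (Z 3 * Y k + Y 3 * Z k) * x) = d k \<longleftrightarrow>
       Tr x = [0, 0, 0, 0, 0] ! k \<and> Tr (1 / \<alpha> * x) = [0, 0, 1, 0, 1] ! k"
      unfolding less_5_iff using Tr_cases[of x] Tr_cases[of "1 / \<alpha> * x"]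
      by (elim disjE) (simp_all only: data_simps mult_1 mult_1_right mult_zero_right mult_zero_left
          add_0_right add_0_left, simp_all only: *, simp_all only: \<gamma>1, simp_all only: single distrib_right abs_trace_add mult_1, simp_all)
  next
    show "(\<Sum>k\<in>{..<5} - {3}. ((vector [0, 0, 1] :: 'a ^ 3) $ 2 * Y k + (vector [0, 0, 1] :: 'a ^ 3) $ 3 * Z k) /
        (Z 3 * Y k + Y 3 * Z k)) = 0"
      by (simp only: sum_less_5_minus data_simps) (simp add: sum)
  qed (simp_all only: sum_less_5_minus data_simps, simp_all)
qed

text \<open>Here 1/\<alpha> = \<beta> + 1, \<alpha>\<beta> + 1 = \<alpha> and \<gamma> = (\<beta> +
  1)^2. After normalisation pieces 0 and 1 have label (0, 0), pieces 2 and 3 label (1, 1).\<close>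

lemma translation_set_axis_4:
  assumes "\<alpha> * (\<beta> + 1) = 1"
  shows "translation_set (line_of (nucleus_axis 4)) (km_set h \<alpha> \<beta>)"
proof -
  define \<tau> where "\<tau> = \<beta> + 1"
  have \<tau>: "\<tau> \<noteq> 0" "1 + \<tau> = \<beta>"
    using \<beta>1 by (simp_all add: \<tau>_def add.left_commute)
  have \<alpha>': "1 / \<alpha> = \<tau>"
    using assms \<alpha>(1) by (simp add: \<tau>_def divide_eq_eq mult.commute)
  have \<alpha>\<tau>: "\<alpha> * \<tau> = 1" using assms by (simp add: \<tau>_def)
  have "\<alpha> * \<beta> + (\<alpha> * \<beta> + \<alpha>) = \<alpha> * \<beta> + 1" using assms by (simp only: distrib_left mult_1_right)
  then have "\<alpha> * \<beta> + 1 = \<alpha>" by simp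
  then have "\<tau> * \<tau> * (\<alpha> * \<beta> + 1) = \<beta> + 1" using \<alpha>\<tau> by (simp add: \<tau>_def mult_ac)
  then have \<gamma>': "\<gamma> = \<tau> * \<tau>" by (rule \<gamma>_eqI)
  have \<alpha>\<gamma>: "\<alpha> * \<gamma> = \<tau>" unfolding \<gamma>' using \<alpha>\<tau> by (simp flip: mult.assoc)
  then have \<xi>': "\<xi> = \<beta> * \<tau>" unfolding \<xi>_eq by (simp add: mult_ac)
  have \<alpha>\<beta>'': "1 / (\<alpha> * \<beta>) * \<beta> = \<tau>" using \<alpha>' \<beta>(1) by simp
  have \<gamma>\<tau>: "\<gamma> + \<tau> = \<tau> * \<beta>" unfolding \<gamma>' unfolding \<tau>(2)[symmetric] by (simp add: algebra_simps)
  have "1 / (\<alpha> * \<gamma>) * \<tau> = 1" "1 / (\<alpha> * \<gamma>) * (\<gamma> + \<tau>) = \<beta>" "1 / \<xi> * (\<gamma> + \<tau>) = 1"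
    unfolding \<alpha>\<gamma> \<gamma>\<tau> \<xi>' using \<tau>(1) \<beta>(1) by simp_all
  note * = this[unfolded \<tau>_def] \<alpha>'[unfolded \<tau>_def] \<alpha>\<beta>''[unfolded \<tau>_def] \<tau>(2)[unfolded \<tau>_def]
  have ** : "1 / (\<gamma> + (\<beta> + 1)) = 1 / (\<tau> * \<beta>)" using \<gamma>\<tau> by (simp add: \<tau>_def)
  \<comment> \<open>The sum of the heights; over the common denominator the numerator is \<beta> +
    \<tau> + 1 = 0.\<close>
  have "1 / \<tau> + (1 / \<beta> + 1 / (\<tau> * \<beta>)) = 0"
    using \<tau>(1) \<beta>(1) by (simp add: field_simps) (simp add: \<tau>_def algebra_simps)
  then have sum: "1 / (\<beta> + 1) + (1 / \<beta> + 1 / (\<gamma> + (\<beta> + 1))) = 0"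
    unfolding ** by (simp only: \<tau>_def)
  have \<beta>2: "1 + (\<beta> + 1) = \<beta>" by (simp add: add.left_commute)
  show ?thesis
  proof (rule translation_set_nucleus_axisI[where b = "vector [0, 0, 1]" and B = "\<beta>"
        and C = "\<lambda>k. [0, 0, 1, 1, 0] ! k" and D = "\<lambda>k. [0, 0, 1, 1, 0] ! k"])
    fix k :: nat and x :: 'a
    assume k: "k < 5" "k \<noteq> 4"
    then show "Tr (p k * (Z 4 * Y k + Y 4 * Z k) * x) = c k \<and> Tr (r k * (Z 4 * Y k + Y 4 * Z k) * x) = d k \<longleftrightarrow>
       Tr x = [0, 0, 1, 1, 0] ! k \<and> Tr (\<beta> * x) = [0, 0, 1, 1, 0] ! k"
      unfolding less_5_iff using Tr_cases[of x] Tr_cases[of "\<beta> * x"]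
      by (elim disjE) (simp_all only: data_simps mult_1 mult_1_right mult_zero_right mult_zero_left
          add_0_right add_0_left, simp_all only: * distrib_right abs_trace_add mult_1, simp_all)
  next
    show "(\<Sum>k\<in>{..<5} - {4}. ((vector [0, 0, 1] :: 'a ^ 3) $ 2 * Y k + (vector [0, 0, 1] :: 'a ^ 3) $ 3 * Z k) /
        (Z 4 * Y k + Y 4 * Z k)) = 0"
      by (simp only: sum_less_5_minus data_simps) (simp add: sum \<beta>2)
  qed (simp_all only: sum_less_5_minus data_simps, simp_all)
qed

subsection \<open>Translation axes of the arc\<close>

text \<open>Every piece is nonempty, so each piece off the axis supplies a normalised vector, at a
  height that depends on k only.\<close>

lemma ex_normalized_in_km_set:
  assumes k: "k < 5" "\<phi> a k \<noteq> 0" and a: "a $ 1 = 0"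
  obtains x where "lform a x = 1" "vec.span {x} \<in> km_set h \<alpha> \<beta>"
    "\<And>b. b $ 1 = 0 \<Longrightarrow> lform b x = \<phi> b k / \<phi> a k"
proof -
  have "card (part k) \<noteq> 0" using card_part[OF k(1)] by (metis finite_UNIV_card_ge_0 finite mult_0_right less_irrefl)
  then have "part k \<noteq> {}" by auto
  then obtain z where z: "pg_point z (Y k) (Z k) \<in> part k" unfolding part_def by blast
  define x :: "'a ^ 3" where "x = (1 / \<phi> a k) *s vector [z, Y k, Z k]"
  have "vec.span {x} = pg_point z (Y k) (Z k)"
    unfolding x_def pg_point_def using k(2) by (simp add: span_scale_eq)
  then have "vec.span {x} \<in> km_set h \<alpha> \<beta>" using z k(1) unfolding km_set_eq by auto
  moreover have b: "lform b x = \<phi> b k / \<phi> a k" if "b $ 1 = 0" for b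
    using that by (simp add: x_def lform_scale lform_vector \<phi>_def)
  moreover from b[OF a] have "lform a x = 1" using k(2) by simp
  ultimately show thesis using that by blast
qed

text \<open>The elation moving a point of piece i to one of piece j adds the difference of their
  heights everywhere, so it takes a point of piece k to the height of some piece. In characteristic
  2 this is a ternary sum.\<close>

lemma translation_set_ternary:
  assumes a: "a \<noteq> 0" "a $ 1 = 0" "b $ 1 = 0"
    and ts: "translation_set (line_of a) (km_set h \<alpha> \<beta>)"
    and K: "K = {k. k < 5 \<and> \<phi> a k \<noteq> 0}" "i \<in> K" "j \<in> K" "k \<in> K"
  shows "\<phi> b k / \<phi> a k + (\<phi> b j / \<phi> a j + \<phi> b i / \<phi> a i) \<in> (\<lambda>k. \<phi> b k / \<phi> a k) ` K"
proof -
  obtain u where u: "lform a u = 1" "vec.span {u} \<in> km_set h \<alpha> \<beta>" "lform b u = \<phi> b i / \<phi> a i"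
    using ex_normalized_in_km_set[of i a] K a by (metis (mono_tags, lifting) mem_Collect_eq)
  obtain v where v: "lform a v = 1" "vec.span {v} \<in> km_set h \<alpha> \<beta>" "lform b v = \<phi> b j / \<phi> a j"
    using ex_normalized_in_km_set[of j a] K a by (metis (mono_tags, lifting) mem_Collect_eq)
  obtain x where x: "lform a x = 1" "vec.span {x} \<in> km_set h \<alpha> \<beta>" "lform b x = \<phi> b k / \<phi> a k"
    using ex_normalized_in_km_set[of k a] K a by (metis (mono_tags, lifting) mem_Collect_eq)
  have "vec.span {w} \<notin> line_of a" if "lform a w = 1" for w
  proof -
    have "w \<noteq> 0" using that by auto
    then show ?thesis using that by (simp add: span_in_line_of)
  qed
  then have "vec.span {u} \<in> km_set h \<alpha> \<beta> - line_of a" "vec.span {v} \<in> km_set h \<alpha> \<beta> - line_of a"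
    using u v by auto
  then obtain f where f: "elation (line_of a) f" "f ` km_set h \<alpha> \<beta> = km_set h \<alpha> \<beta>"
    "f (vec.span {u}) = vec.span {v}"
    using ts unfolding translation_set_def by meson
  have "f (vec.span {x}) = vec.span {x + v - u}"
    by (rule elation_translation[OF a(1) f(1) u(1) v(1) f(3) x(1)])
  moreover have "f (vec.span {x}) \<in> km_set h \<alpha> \<beta>"
    using imageI[OF x(2), of f] unfolding f(2) .
  ultimately have mem: "vec.span {x + v - u} \<in> km_set h \<alpha> \<beta>" by simp
  have "lform a (x + v - u) = 1" using u v x by (simp add: lform_linear)
  then obtain l where l: "l < 5" "\<phi> a l \<noteq> 0" "(x + v - u) $ 2 = Y l / \<phi> a l" "(x + v - u) $ 3 = Z l / \<phi> a l"
    using mem normalized_in_km_set_iff[OF _ a(2)] by blast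
  have "lform b (x + v - u) = \<phi> b l / \<phi> a l"
    by (rule lform_eq_\<phi>[OF a(3) l(3,4)])
  moreover have "lform b (x + v - u) = \<phi> b k / \<phi> a k + (\<phi> b j / \<phi> a j + \<phi> b i / \<phi> a i)"
    using u v x by (simp add: lform_linear minus_eq_add add.assoc)
  ultimately show ?thesis using l(1,2) K(1) by auto
qed

text \<open>Multiplicativity of the 2 by 2 determinant: the cross difference of the \<phi> values is
  the determinant of \<open>a\<close> and \<open>b\<close> times that of the two pencil
  points.\<close>

lemma \<phi>_quotient_inj:
  assumes "a $ 2 * b $ 3 + a $ 3 * b $ 2 \<noteq> 0" "j < 5" "k < 5" "\<phi> a j \<noteq> 0" "\<phi> a k \<noteq> 0"
    "\<phi> b j / \<phi> a j = \<phi> b k / \<phi> a k"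
  shows "j = k"
proof (rule nucleus_lines_distinct[OF assms(2,3)])
  have "\<phi> b j * \<phi> a k + \<phi> b k * \<phi> a j = 0"
    using assms(4-6) by (simp add: add_eq_0_iff_eq frac_eq_eq)
  moreover have "\<phi> b j * \<phi> a k + \<phi> b k * \<phi> a j =
      (a $ 2 * b $ 3 + a $ 3 * b $ 2) * (Y j * Z k + Y k * Z j)"
    by (simp add: \<phi>_def algebra_simps)
  ultimately show "Y j * Z k = Y k * Z j" using assms(1) by (simp add: add_eq_0_iff_eq)
qed

lemma translation_axis_meets_km_set:
  assumes a: "a \<noteq> 0" "a $ 1 = 0" and ts: "translation_set (line_of a) (km_set h \<alpha> \<beta>)"
  shows "\<exists>k<5. \<phi> a k = 0"
proof (rule ccontr)
  assume "\<not> ?thesis"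
  then have nz: "\<phi> a k \<noteq> 0" if "k < 5" for k using that by blast
  have a23: "a $ 2 \<noteq> 0 \<or> a $ 3 \<noteq> 0" using a by (auto simp: vec_eq_iff forall_3)
  \<comment> \<open>A form independent of \<open>a\<close> that also vanishes at the
    nucleus.\<close>
  define b :: "'a ^ 3" where "b = (if a $ 2 \<noteq> 0 then vector [0, 0, 1] else vector [0, 1, 0])"
  have b: "b $ 1 = 0" "a $ 2 * b $ 3 + a $ 3 * b $ 2 \<noteq> 0" using a23 by (auto simp: b_def)
  define K where "K = {k. k < 5 \<and> \<phi> a k \<noteq> 0}"
  have K: "K = {..<5}" using nz by (auto simp: K_def)
  define t where "t k = \<phi> b k / \<phi> a k" for k
  have inj: "inj_on t K"
    unfolding inj_on_def t_def K using \<phi>_quotient_inj[OF b(2)] nz by auto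
  have "t k + (t 1 + t 0) \<in> t ` K" if "k \<in> K" for k
    unfolding t_def by (rule translation_set_ternary[OF a b(1) ts K_def]) (use that K in auto)
  then have "(\<lambda>x. x + (t 1 + t 0)) ` (t ` K) \<subseteq> t ` K" by auto
  moreover have "t 1 + t 0 \<noteq> 0"
    using inj K by (simp add: add_eq_0_iff_eq inj_on_eq_iff)
  moreover have "finite (t ` K)" using K by simp
  ultimately have "of_nat (card (t ` K)) = (0::'a)"
    by (intro of_nat_card_translation_invariant)
  then have "of_nat 5 = (0::'a)" using inj K by (simp add: card_image)
  \<comment> \<open>Splits 5 as 1 + 2 * 2, which is 1 in characteristic 2.\<close>
  moreover have "of_nat (1 + 2 * 2) = 1 + of_nat 2 * (of_nat 2 :: 'a)"
    by (simp only: of_nat_add of_nat_mult of_nat_1)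
  ultimately show False by simp
qed

text \<open>Substituting \<gamma> = (\<beta> + 1)/G turns the sum of the heights into a rational
  function of \<alpha> and \<beta>, whose numerator is the equation of the axis up to nonzero
  factors.\<close>

lemma condition_if_sum_zero:
  assumes "j < 5" "b = (if j = 0 then vector [0, 1, 0] else vector [0, 0, 1])"
    "(\<Sum>k\<in>{..<5} - {j}. \<phi> b k / \<phi> (nucleus_axis j) k) = 0"
  shows "condition j"
proof -
  define G where "G = \<alpha> * \<beta> + 1"
  have G: "G \<noteq> 0" "\<gamma> * G = \<beta> + 1" using \<alpha>\<beta>1 \<gamma>_mult by (simp_all add: G_def)
  have \<beta>2: "\<beta> + 1 + 1 = \<beta>" by (simp add: add.assoc)
  have inv: "1 / x = G / y" if "x * G = y" "y \<noteq> 0" for x y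
    using that G(1) by auto
  have i1: "1 / \<gamma> = G / (\<beta> + 1)" by (rule inv) (use G(2) \<beta>1 in auto)
  have i2: "1 / (\<gamma> + 1) = G / (\<beta> * (\<alpha> + 1))"
  proof (rule inv)
    have "(\<gamma> + 1) * G = (\<beta> + 1) + G" using G(2) by (simp add: distrib_right)
    then show "(\<gamma> + 1) * G = \<beta> * (\<alpha> + 1)" by (simp add: G_def algebra_simps)
    show "\<beta> * (\<alpha> + 1) \<noteq> 0" using \<beta>(1) \<alpha>1 by simp
  qed
  have i3: "1 / (\<gamma> + (\<beta> + 1)) = G / ((\<beta> + 1) * (\<alpha> * \<beta>))"
  proof (rule inv)
    have "(\<gamma> + (\<beta> + 1)) * G = (\<beta> + 1) + (\<beta> + 1) * G" using G(2) by (simp add: distrib_right)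
    then show "(\<gamma> + (\<beta> + 1)) * G = (\<beta> + 1) * (\<alpha> * \<beta>)" by (simp add: G_def algebra_simps)
    show "(\<beta> + 1) * (\<alpha> * \<beta>) \<noteq> 0" using \<beta>(1) \<alpha>(1) \<beta>1 by simp
  qed
  \<comment> \<open>The factors of the denominators are variables here, later replaced by \<beta> +
    1, \<alpha> + 1, \<alpha> and \<beta>, so that \<open>field_simps\<close> clears them without
    multiplying them out.\<close>
  have clear3: "(t * (x * y) * s) * (G / t + (G / (y * s) + G / (t * (x * y)))) = G * (x * y * s + (x * t + s))"
    if "t \<noteq> 0" "s \<noteq> 0" "x \<noteq> 0" "y \<noteq> 0" for t s x y G :: 'a
    using that by (simp add: field_simps)
  have clear2: "(y * s) * (1 + (G / (y * s) + 1 / y)) = y * s + (G + s)"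
    if "s \<noteq> 0" "y \<noteq> 0" for s y G :: 'a
    using that by (simp add: field_simps)
  have clear4: "(t * (x * y)) * (1 / t + (1 / y + G / (t * (x * y)))) = x * y + (t * x + G)"
    if "t \<noteq> 0" "x \<noteq> 0" "y \<noteq> 0" for t x y G :: 'a
    using that by (simp add: field_simps)
  consider "j = 0" | "j = 1" | "j = 2" | "j = 3" | "j = 4" using assms(1) unfolding less_5_iff by blast
  then show ?thesis
  proof cases
    case 1
    then have "0 + (1 + (\<gamma> + (\<beta> + 1))) = 0"
      using assms(2,3) by (simp only: sum_less_5_minus \<phi>_def nucleus_axis_simps data_simps) simp
    then have "\<gamma> + \<beta> = 0" by (simp add: add.commute add.left_commute)
    then have "\<gamma> = \<beta>" by (simp only: add_eq_0_iff_eq)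
    then have "\<beta> * (\<alpha> * \<beta>) + \<beta> = \<beta> + 1" using \<gamma>_mult by (simp add: distrib_left)
    then have "\<beta> * (\<alpha> * \<beta>) = 1" by (simp add: add.commute[of \<beta>])
    then show ?thesis unfolding 1 condition_simps by (simp add: power2_eq_square mult_ac)
  next
    case 2
    then have "0 + (1 + (1 / \<gamma> + 1 / (\<beta> + 1))) = 0"
      using assms(2,3) by (simp only: sum_less_5_minus \<phi>_def nucleus_axis_simps data_simps) simp
    then have "(\<beta> + 1) * (1 + (G / (\<beta> + 1) + 1 / (\<beta> + 1))) = 0" unfolding i1 by simp
    then have "(\<beta> + 1) + (G + 1) = 0" using \<beta>1 by (simp only: distrib_left) simp
    then have "\<alpha> * \<beta> + (\<beta> + 1) = 0" by (simp add: G_def add_ac)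
    then show ?thesis unfolding 2 condition_simps by (simp only: add_eq_0_iff_eq)
  next
    case 3
    then have "0 + (1 + (1 / (\<gamma> + 1) + 1 / \<beta>)) = 0"
      using assms(2,3) by (simp only: sum_less_5_minus \<phi>_def nucleus_axis_simps data_simps) (simp add: \<beta>2)
    then have "(\<beta> * (\<alpha> + 1)) * (1 + (G / (\<beta> * (\<alpha> + 1)) + 1 / \<beta>)) = 0" unfolding i2 by simp
    then have "\<beta> * (\<alpha> + 1) + (G + (\<alpha> + 1)) = 0" unfolding clear2[OF \<alpha>1 \<beta>(1)] .
    then have "\<alpha> + \<beta> = 0" by (simp add: G_def algebra_simps)
    then show ?thesis unfolding 3 condition_simps by (simp only: add_eq_0_iff_eq)
  next
    case 4
    then have "0 + (1 / \<gamma> + (1 / (\<gamma> + 1) + 1 / (\<gamma> + (\<beta> + 1)))) = 0"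
      using assms(2,3) by (simp only: sum_less_5_minus \<phi>_def nucleus_axis_simps data_simps) (simp add: add_ac)
    then have "G / (\<beta> + 1) + (G / (\<beta> * (\<alpha> + 1)) + G / ((\<beta> + 1) * (\<alpha> * \<beta>))) = 0"
      unfolding i1 i2 i3 by simp
    then have "G * (\<alpha> * \<beta> * (\<alpha> + 1) + (\<alpha> * (\<beta> + 1) + (\<alpha> + 1))) = 0"
      using clear3[of "\<beta> + 1" "\<alpha> + 1" \<alpha> \<beta> G] \<beta>1 \<alpha>1 \<alpha>(1) \<beta>(1) by simp
    then have "\<alpha> * \<beta> * (\<alpha> + 1) + (\<alpha> * (\<beta> + 1) + (\<alpha> + 1)) = 0" using G(1) by simp
    then have "\<alpha>\<^sup>2 * \<beta> + 1 = 0" by (simp add: algebra_simps power2_eq_square)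
    then show ?thesis unfolding 4 condition_simps by (simp only: add_eq_0_iff_eq)
  next
    case 5
    then have "0 + (1 / (\<beta> + 1) + (1 / \<beta> + 1 / (\<gamma> + (\<beta> + 1)))) = 0"
      using assms(2,3) by (simp only: sum_less_5_minus \<phi>_def nucleus_axis_simps data_simps) (simp add: \<beta>2 add_ac)
    then have "((\<beta> + 1) * (\<alpha> * \<beta>)) * (1 / (\<beta> + 1) + (1 / \<beta> + G / ((\<beta> + 1) * (\<alpha> * \<beta>)))) = 0"
      unfolding i3 by simp
    then have "\<alpha> * \<beta> + ((\<beta> + 1) * \<alpha> + G) = 0" unfolding clear4[OF \<beta>1 \<alpha>(1) \<beta>(1)] .
    then have "\<alpha> * (\<beta> + 1) + 1 = 0" by (simp add: G_def algebra_simps)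
    then show ?thesis unfolding 5 condition_simps by (simp only: add_eq_0_iff_eq)
  qed
qed

lemma line_of_eq_nucleus_axis:
  assumes "a \<noteq> 0" "a $ 1 = 0" "j < 5" "\<phi> a j = 0"
  shows "line_of a = line_of (nucleus_axis j)"
proof -
  have eq: "a $ 2 * Y j = a $ 3 * Z j" using assms(4) by (simp add: \<phi>_def add_eq_0_iff_eq)
  have "\<exists>e. a = e *s nucleus_axis j"
  proof (cases "Z j = 0")
    case True
    then have "Y j \<noteq> 0" using YZ_nz[OF assms(3)] by simp
    then show ?thesis using eq True assms(2)
      by (intro exI[of _ "a $ 3 / Y j"]) (simp add: vec_eq_iff forall_3)
  next
    case False
    then show ?thesis using eq assms(2)
      by (intro exI[of _ "a $ 2 / Z j"]) (simp add: vec_eq_iff forall_3)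
  qed
  then obtain e where e: "a = e *s nucleus_axis j" by blast
  then have "e \<noteq> 0" using assms(1) by auto
  then show ?thesis using e by (simp add: line_of_scale)
qed

lemma translation_set_imp_condition:
  assumes j: "j < 5" and ts: "translation_set (line_of (nucleus_axis j)) (km_set h \<alpha> \<beta>)"
  shows "condition j"
proof (rule condition_if_sum_zero[OF j refl])
  \<comment> \<open>The form (0, 0, 1) is independent of the axis whenever \<open>Z j\<close> is
    nonzero; only the axis of piece 0 requires another choice.\<close>
  define b :: "'a ^ 3" where "b = (if j = 0 then vector [0, 1, 0] else vector [0, 0, 1])"
  let ?a = "nucleus_axis j"
  have Zj: "Z j \<noteq> 0" if "j \<noteq> 0" using that j by (auto simp: less_5_iff data_simps)
  then have b: "b $ 1 = 0" "?a $ 2 * b $ 3 + ?a $ 3 * b $ 2 \<noteq> 0"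
    by (auto simp: b_def data_simps)
  define K where "K = {k. k < 5 \<and> \<phi> ?a k \<noteq> 0}"
  have K: "K = {..<5} - {j}" using \<phi>_nucleus_axis_eq_0_iff[OF j] by (auto simp: K_def)
  have "(\<Sum>k\<in>K. \<phi> b k / \<phi> ?a k) = 0"
  proof (rule translation_invariant_sum_zero)
    show "card K = 4" using K j by simp
    show "inj_on (\<lambda>k. \<phi> b k / \<phi> ?a k) K"
      unfolding inj_on_def K_def using \<phi>_quotient_inj[OF b(2)] by auto
    show "\<phi> b k / \<phi> ?a k + (\<phi> b i' / \<phi> ?a i' + \<phi> b i / \<phi> ?a i) \<in> (\<lambda>k. \<phi> b k / \<phi> ?a k) ` K"
      if "i \<in> K" "i' \<in> K" "k \<in> K" for i i' k
      using translation_set_ternary[OF nucleus_axis_nz[OF j] _ b(1) ts K_def that] by simp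
  qed
  then show "(\<Sum>k\<in>{..<5} - {j}. \<phi> (if j = 0 then vector [0, 1, 0] else vector [0, 0, 1]) k / \<phi> ?a k) = 0"
    unfolding K b_def .
qed

text \<open>If the axis missed the nucleus, an elation would move a point of piece 0 to a point
  \<open>Q\<close> of piece 1. It maps the line of piece 0 to a line through the nucleus, since the
  image has more than two points of the arc, and fixes the point \<open>X\<close> where that line
  meets the axis. Nucleus and \<open>X\<close> force the image to be the line itself, which misses
  \<open>Q\<close>.\<close>

lemma translation_axis_through_nucleus:
  assumes q: "CARD('a) div 4 > 2" and ts: "translation_set (line_of a) (km_set h \<alpha> \<beta>)"
  shows "a $ 1 = 0"
proof (rule ccontr)
  assume a1: "a $ 1 \<noteq> 0"
  let ?S = "km_set h \<alpha> \<beta>"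
  define N where "N = (pg_point 1 0 0 :: ('a ^ 3) set)"
  have N: "N = vec.span {vector [1, 0, 0]}" "(vector [1, 0, 0] :: 'a ^ 3) \<noteq> 0"
    by (simp_all add: N_def pg_point_def vector_3_eq_0_iff)
  have N_line: "N \<in> line_of b \<longleftrightarrow> b $ 1 = 0" for b
    unfolding N(1) span_in_line_of[OF N(2)] by (simp add: lform_vector)
  \<comment> \<open>An axis missing the nucleus meets the arc in at most two points, fewer than a
    piece has.\<close>
  have off_axis: "\<exists>P. P \<in> part k - line_of a" if k: "k < 5" for k
  proof (rule ccontr)
    assume "\<not> ?thesis"
    then have "part k \<subseteq> line_of a" by blast
    moreover have "part k \<subseteq> ?S" using k unfolding km_set_eq by blast
    ultimately have "card (part k) \<le> card (?S \<inter> line_of a)"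
      by (intro card_mono) auto
    then show False using card_line_not_through_nucleus[OF a1] card_part_eq[OF k] q by auto
  qed
  obtain P where P: "P \<in> part 0" "P \<notin> line_of a" using off_axis[of 0] by auto
  obtain Q where Q: "Q \<in> part 1" "Q \<notin> line_of a" using off_axis[of 1] by auto
  have "P \<in> ?S" "Q \<in> ?S" using P Q unfolding km_set_eq by (auto intro: bexI[of _ 0] bexI[of _ 1])
  then obtain f where f: "elation (line_of a) f" "f ` ?S = ?S" "f P = Q"
    using ts P Q unfolding translation_set_def by (meson DiffI)
  have coll: "collineation f" using f(1) by (simp only: elation_def)
  then have inj: "inj_on f pg_points" by (simp only: collineation_def bij_betw_def)
  have lines: "image f ` pg_lines = pg_lines" using coll by (simp only: collineation_def bij_betw_def)
  have image_line: "\<exists>b. b \<noteq> 0 \<and> b $ 1 = 0 \<and> f ` line_of (nucleus_axis k) = line_of b" if k: "k < 5" for k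
  proof -
    let ?m = "line_of (nucleus_axis k)"
    have m: "?m \<in> pg_lines" using nucleus_axis_nz[OF k] pg_lines_eq by blast
    then have "f ` ?m \<in> pg_lines" using lines by blast
    then obtain b where b: "b \<noteq> 0" "f ` ?m = line_of b" using pg_lines_eq by blast
    have "?S \<inter> ?m = part k"
      by (rule km_set_line_through_nucleus[OF nucleus_axis_nz[OF k] _ k]) (simp_all add: mult.commute)
    have "?S \<inter> line_of b = f ` (?S \<inter> ?m)"
      using inj_on_image_Int[OF inj km_set_points, of ?m] f(2) b(2) unfolding line_of_def by auto
    also have "card \<dots> = card (?S \<inter> ?m)"
      using inj km_set_points by (intro card_image) (meson inj_on_subset le_infI1)
    also have "\<dots> > 2"
      using \<open>?S \<inter> ?m = part k\<close> card_part_eq[OF k] q by simp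
    finally have "card (?S \<inter> line_of b) > 2" .
    then have "b $ 1 = 0" using card_line_not_through_nucleus[of b] by fastforce
    then show ?thesis using b by blast
  qed
  have N_axis: "N \<in> f ` line_of (nucleus_axis k)" if "k < 5" for k
    using image_line[OF that] N_line by blast
  obtain b where b: "b \<noteq> 0" "b $ 1 = 0" "f ` line_of (nucleus_axis 0) = line_of b"
    using image_line[of 0] by auto
  \<comment> \<open>The intersection of the axis with the line of piece 0, solved from
    \<open>Y 0 = 1\<close> and \<open>Z 0 = 0\<close>.\<close>
  define X where "X = (pg_point (a $ 2 / a $ 1) (Y 0) (Z 0) :: ('a ^ 3) set)"
  have "X \<in> line_of a" "X \<in> line_of (nucleus_axis 0)"
    unfolding X_def pg_point_in_line_of[OF zero_less_numeral] using a1 by (simp_all add: data_simps)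
  moreover from this have "f X = X" using f(1) by (simp only: elation_def)
  ultimately have "X \<in> line_of b" using b(3) by (metis imageI)
  then have b2: "b $ 2 = 0"
    unfolding X_def pg_point_in_line_of[OF zero_less_numeral] using b(2) by (simp add: data_simps)
  have "P \<in> line_of (nucleus_axis 0)"
    using P(1) pg_point_in_line_of[of 0 _ "nucleus_axis 0"] unfolding part_def by (auto simp: data_simps)
  then have "Q \<in> line_of b" using b(3) f(3) by (metis imageI)
  \<comment> \<open>Points of piece 1 have the form (z, 0, 1), so only the third coefficient is
    tested.\<close>
  then have "b $ 3 = 0"
    using Q(1) b(2) b2 pg_point_in_line_of[of 1 _ b] unfolding part_def by (auto simp: data_simps)
  then show False using b(1,2) b2 by (simp add: vec_eq_iff forall_3)
qed

end

theorem theorem4p9: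
  fixes \<alpha> \<beta> :: "'a::{field,finite}" and h :: nat
  assumes "CARD('a) = 2 ^ h"
    and "\<alpha> \<notin> {0, 1}" and "\<beta> \<notin> {0, 1}" and "\<alpha> * \<beta> \<noteq> 1"
  shows "translation_KM_arc (CARD('a) div 4) (km_set h \<alpha> \<beta>) \<longleftrightarrow>
    \<alpha> \<in> {1 / \<beta>\<^sup>2, 1 + 1 / \<beta>, \<beta>, 1 / field_sqrt \<beta>, 1 / (\<beta> + 1)}"
proof -
  interpret km_parameters "TYPE('a)" h \<alpha> \<beta>
    using assms by unfold_locales auto
  have "translation_KM_arc (CARD('a) div 4) (km_set h \<alpha> \<beta>) \<longleftrightarrow> (\<exists>k<5. condition k)"
  proof
    assume "translation_KM_arc (CARD('a) div 4) (km_set h \<alpha> \<beta>)"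
    then obtain a where a: "a \<noteq> 0" "translation_set (line_of a) (km_set h \<alpha> \<beta>)"
      unfolding translation_KM_arc_def pg_lines_eq by blast
    show "\<exists>k<5. condition k"
    \<comment> \<open>As q is a power of 2, this separates q > 8 from q \<le> 8.\<close>
    proof (cases "CARD('a) div 4 > 2")
      case True
      then have a1: "a $ 1 = 0" using a(2) by (rule translation_axis_through_nucleus)
      then obtain k where k: "k < 5" "\<phi> a k = 0" using translation_axis_meets_km_set[OF a(1) _ a(2)] by blast
      then have "translation_set (line_of (nucleus_axis k)) (km_set h \<alpha> \<beta>)"
        using a(2) line_of_eq_nucleus_axis[OF a(1) a1 k] by simp
      then show ?thesis using translation_set_imp_condition k(1) by blast
    next
      case False
      then show ?thesis by (intro small_field_condition) simp
    qed
  next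
    assume "\<exists>k<5. condition k"
    then obtain k where k: "k < 5" "translation_set (line_of (nucleus_axis k)) (km_set h \<alpha> \<beta>)"
      unfolding Ex_less_5 condition_simps
      using translation_set_axis_0 translation_set_axis_1 translation_set_axis_2
        translation_set_axis_3 translation_set_axis_4 by (metis less_5_iff)
    then show "translation_KM_arc (CARD('a) div 4) (km_set h \<alpha> \<beta>)"
      unfolding translation_KM_arc_def using KM_arc_km_set nucleus_axis_nz[OF k(1)] pg_lines_eq by blast
  qed
  then show ?thesis unfolding ex_condition_iff .
qed

end
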